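(* Let $k$ be an algebraically closed field of characteristic $0$ and $R=\mathcal{O}(GL_2)$. For any pair of Poisson $\mathcal{H}$-primes $J\subset K$ in $R$, we have \[\varphi_{JK}=f_{JK}^{\circ}\overline{|}g_{JK}^{\circ}\] as maps $CL(\mathrm{pspec}_J(R))\to CL(\mathrm{pspec}_K(R))$.
   Context: $\mathcal{O}(M_2)=k[a,b,c,d]$, with $a=Y_{11}$, $b=Y_{12}$, $c=Y_{21}$, $d=Y_{22}$, has Poisson bracket $\{a,b\}=ab$, $\{a,c\}=ac$, $\{b,d\}=bd$, $\{c,d\}=cd$, $\{b,c\}=0$, $\{a,d\}=2bc$. The determinant $D=ad-bc$ is Poisson central and $\mathcal{O}(GL_2)=\mathcal{O}(M_2)[D^{-1}]$ with the unique extension of the bracket. The torus $\mathcal{H}=(k^\times)^4$ acts on $\mathcal{O}(GL_2)$ by Poisson automorphisms via $(\alpha_1,\alpha_2,\beta_1,\beta_2).Y_{ij}=\alpha_i\beta_jY_{ij}$; nonzero $\mathcal{H}$-eigenvectors are called homogeneous. A Poisson prime is a prime ideal $P$ with $\{P,R\}\subseteq P$; $\mathrm{pspec}(R)$ is the set of these, with closed sets $V(I)=\{P\in\mathrm{pspec}(R):P\supseteq I\}$. A Poisson $\mathcal{H}$-prime is an $\mathcal{H}$-invariant Poisson prime. For a Poisson $\mathcal{H}$-prime $J$, $\mathrm{pspec}_J(R)=\{P\in\mathrm{pspec}(R):\bigcap_{h\in\mathcal{H}}h(P)=J\}$ with the subspace topology. $CL(T)$ is the set of closed subsets of a space $T$.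 $\mathcal{PZ}(S)=\{z\in S:\{z,S\}=0\}$ is the Poisson centre of a Poisson algebra $S$. Poisson brackets pass to quotients by Poisson ideals and extend uniquely to localizations. For Poisson $\mathcal{H}$-primes $J\subset K$: $\mathcal{E}_J$ is the set of all nonzero homogeneous elements of $R/J$ and $R_J=(R/J)[\mathcal{E}_J^{-1}]$. The map $P\mapsto (P/J)R_J\cap\mathcal{PZ}(R_J)$ is a homeomorphism $\mathrm{pspec}_J(R)\to\mathrm{spec}(\mathcal{PZ}(R_J))$ (known), used to identify these spaces. $\varphi_{JK}:CL(\mathrm{pspec}_J(R))\to CL(\mathrm{pspec}_K(R))$ is $\varphi_{JK}(Y)=\overline{Y}\cap\mathrm{pspec}_K(R)$, closure in $\mathrm{pspec}(R)$. $\mathcal{E}_{JK}=\{c\in R/J: c\text{ homogeneous},\ c\notin K/J\}$ and $\mathcal{PZ}_{JK}=\mathcal{PZ}((R/J)[\mathcal{E}_{JK}^{-1}])$. $g_{JK}:\mathcal{PZ}_{JK}\hookrightarrow\mathcal{PZ}(R_J)$ is the inclusion, and $f_{JK}:\mathcal{PZ}_{JK}\to\mathcal{PZ}(R_K)$ is the homomorphism $ab^{-1}\mapsto\pi_{JK}(a)\pi_{JK}(b)^{-1}$, where $\pi_{JK}:R/J\to R/K$ is the projection. For a homomorphism $h:S\to T$ of commutative algebras, $h^\circ:\mathrm{spec}(T)\to\mathrm{spec}(S)$, $Q\mapsto h^{-1}(Q)$. Finally $f_{JK}^\circ\overline{|}g_{JK}^\circ(Y)=(f_{JK}^{\circ})^{-1}\big(\overline{g_{JK}^\circ(Y)}\big)$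 for $Y\in CL(\mathrm{spec}(\mathcal{PZ}(R_J)))$, viewed via the identifications above as a map $CL(\mathrm{pspec}_J(R))\to CL(\mathrm{pspec}_K(R))$. *)

theory Defs
  imports
    "HOL-Analysis.Abstract_Topology"
    "HOL-Computational_Algebra.Polynomial"
    "HOL-Computational_Algebra.Fraction_Field"
    "HOL-Algebra.QuotRing"
begin

section \<open>Generic constructions on commutative (Poisson) rings\<close>

text \<open>A Poisson ring is a \<^typ>\<open>'a ring\<close> together with a bracket \<open>br :: 'a \<Rightarrow> 'a \<Rightarrow> 'a\<close>,
  which is passed as a separate argument.\<close>

subsection \<open>Quotients\<close>

text \<open>For ideals \<open>J \<subseteq> P\<close> of \<open>R\<close>, the ideal \<open>P / J\<close> of \<open>R Quot J\<close>.\<close>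

definition ideal_quot :: "('a, 'm) ring_scheme \<Rightarrow> 'a set \<Rightarrow> 'a set \<Rightarrow> 'a set set" where
  "ideal_quot R J P = (\<lambda>x. J +>\<^bsub>R\<^esub> x) ` P"

text \<open>As in \<^const>\<open>rcoset_mult\<close>, the union runs over representatives; for a Poisson ideal \<open>J\<close>
  all members of the union coincide. The same idiom is used for all operations below.\<close>

definition quot_br :: "('a, 'm) ring_scheme \<Rightarrow> ('a \<Rightarrow> 'a \<Rightarrow> 'a) \<Rightarrow> 'a set
    \<Rightarrow> 'a set \<Rightarrow> 'a set \<Rightarrow> 'a set" where
  "quot_br R br J X Y = (\<Union>x\<in>X. \<Union>y\<in>Y. J +>\<^bsub>R\<^esub> br x y)"

text \<open>The projection \<open>R Quot J \<rightarrow> R Quot K\<close>, \<open>x + J \<mapsto> x + K\<close>, for ideals \<open>J \<subseteq> K\<close>.\<close>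

definition quot_proj :: "('a, 'm) ring_scheme \<Rightarrow> 'a set \<Rightarrow> 'a set \<Rightarrow> 'a set" where
  "quot_proj R K X = (\<Union>x\<in>X. K +>\<^bsub>R\<^esub> x)"

subsection \<open>Localization at a multiplicative subset\<close>

text \<open>The fraction \<open>a / s\<close> in \<open>A[S\<^sup>-\<^sup>1]\<close>, as an equivalence class of pairs.\<close>

definition fraction :: "('a, 'm) ring_scheme \<Rightarrow> 'a set \<Rightarrow> 'a \<Rightarrow> 'a \<Rightarrow> ('a \<times> 'a) set" where
  "fraction A S a s = {(b, t). b \<in> carrier A \<and> t \<in> S \<and>
      (\<exists>u\<in>S. u \<otimes>\<^bsub>A\<^esub> (t \<otimes>\<^bsub>A\<^esub> a) = u \<otimes>\<^bsub>A\<^esub> (s \<otimes>\<^bsub>A\<^esub> b))}"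

definition loc_ring :: "('a, 'm) ring_scheme \<Rightarrow> 'a set \<Rightarrow> ('a \<times> 'a) set ring" where
  "loc_ring A S =
    \<lparr>carrier = {fraction A S a s | a s. a \<in> carrier A \<and> s \<in> S},
     mult = (\<lambda>X Y. \<Union>(a, s)\<in>X. \<Union>(b, t)\<in>Y. fraction A S (a \<otimes>\<^bsub>A\<^esub> b) (s \<otimes>\<^bsub>A\<^esub> t)),
     one = fraction A S \<one>\<^bsub>A\<^esub> \<one>\<^bsub>A\<^esub>,
     zero = fraction A S \<zero>\<^bsub>A\<^esub> \<one>\<^bsub>A\<^esub>,
     add = (\<lambda>X Y. \<Union>(a, s)\<in>X. \<Union>(b, t)\<in>Y.
              fraction A S ((t \<otimes>\<^bsub>A\<^esub> a) \<oplus>\<^bsub>A\<^esub> (s \<otimes>\<^bsub>A\<^esub> b)) (s \<otimes>\<^bsub>A\<^esub> t))\<rparr>"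

text \<open>The unique extension of the bracket to the localization,
  \<open>{a/s, b/t} = (s t {a,b} - a t {s,b} - s b {a,t} + a b {s,t}) / (s\<^sup>2 t\<^sup>2)\<close>.\<close>

definition loc_br :: "('a, 'm) ring_scheme \<Rightarrow> ('a \<Rightarrow> 'a \<Rightarrow> 'a) \<Rightarrow> 'a set
    \<Rightarrow> ('a \<times> 'a) set \<Rightarrow> ('a \<times> 'a) set \<Rightarrow> ('a \<times> 'a) set" where
  "loc_br A br S X Y = (\<Union>(a, s)\<in>X. \<Union>(b, t)\<in>Y.
     fraction A S
       ((((s \<otimes>\<^bsub>A\<^esub> t) \<otimes>\<^bsub>A\<^esub> br a b) \<ominus>\<^bsub>A\<^esub> ((a \<otimes>\<^bsub>A\<^esub> t) \<otimes>\<^bsub>A\<^esub> br s b)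
          \<ominus>\<^bsub>A\<^esub> ((s \<otimes>\<^bsub>A\<^esub> b) \<otimes>\<^bsub>A\<^esub> br a t)) \<oplus>\<^bsub>A\<^esub> ((a \<otimes>\<^bsub>A\<^esub> b) \<otimes>\<^bsub>A\<^esub> br s t))
       ((s \<otimes>\<^bsub>A\<^esub> s) \<otimes>\<^bsub>A\<^esub> (t \<otimes>\<^bsub>A\<^esub> t)))"

text \<open>For an ideal \<open>I\<close> of \<open>A\<close>, the extended ideal \<open>I A[S\<^sup>-\<^sup>1]\<close>.\<close>

definition loc_ext :: "('a, 'm) ring_scheme \<Rightarrow> 'a set \<Rightarrow> 'a set \<Rightarrow> ('a \<times> 'a) set set" where
  "loc_ext A S I = Idl\<^bsub>loc_ring A S\<^esub> ((\<lambda>x. fraction A S x \<one>\<^bsub>A\<^esub>) ` I)"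

text \<open>The map \<open>A[S\<^sup>-\<^sup>1] \<rightarrow> B[T\<^sup>-\<^sup>1]\<close>, \<open>a/s \<mapsto> p(a)/p(s)\<close>, induced by a homomorphism \<open>p\<close>
  with \<open>p ` S \<subseteq> T\<close>.\<close>

definition loc_map :: "('b, 'm) ring_scheme \<Rightarrow> 'b set \<Rightarrow> ('a \<Rightarrow> 'b)
    \<Rightarrow> ('a \<times> 'a) set \<Rightarrow> ('b \<times> 'b) set" where
  "loc_map B T p X = (\<Union>(a, s)\<in>X. fraction B T (p a) (p s))"

subsection \<open>The Poisson centre, as a subring\<close>

definition pcentre :: "('a, 'm) ring_scheme \<Rightarrow> ('a \<Rightarrow> 'a \<Rightarrow> 'a) \<Rightarrow> ('a, 'm) ring_scheme" where
  "pcentre A br = A\<lparr>carrier := {z \<in> carrier A. \<forall>x\<in>carrier A. br z x = \<zero>\<^bsub>A\<^esub>}\<rparr>"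

subsection \<open>Spaces of prime ideals\<close>

text \<open>The topology on a set \<open>X\<close> of prime ideals of \<open>A\<close> whose closed sets are the
  \<open>V(I) = {P \<in> X. I \<subseteq> P}\<close>, see \<open>closedin_zariski\<close> below.\<close>

definition zariski :: "('a, 'm) ring_scheme \<Rightarrow> 'a set set \<Rightarrow> 'a set topology" where
  "zariski A X = topology (\<lambda>U. \<exists>I. ideal I A \<and> U = {P \<in> X. \<not> I \<subseteq> P})"

definition spec :: "('a, 'm) ring_scheme \<Rightarrow> 'a set set" where
  "spec A = {P. primeideal P A}"

definition pspec :: "('a, 'm) ring_scheme \<Rightarrow> ('a \<Rightarrow> 'a \<Rightarrow> 'a) \<Rightarrow> 'a set set" where
  "pspec A br = {P. primeideal P A \<and> (\<forall>x\<in>P. \<forall>y\<in>carrier A. br x y \<in> P)}"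

abbreviation spec_top :: "('a, 'm) ring_scheme \<Rightarrow> 'a set topology" where
  "spec_top A \<equiv> zariski A (spec A)"

abbreviation pspec_top :: "('a, 'm) ring_scheme \<Rightarrow> ('a \<Rightarrow> 'a \<Rightarrow> 'a) \<Rightarrow> 'a set topology" where
  "pspec_top A br \<equiv> zariski A (pspec A br)"

definition CL :: "'a topology \<Rightarrow> 'a set set" where
  "CL T = {Y. closedin T Y}"

text \<open>The map \<open>h\<^sup>\<circ> : spec T \<rightarrow> spec S\<close> for \<open>h : S \<rightarrow> T\<close>.\<close>

definition spec_map :: "('a, 'm) ring_scheme \<Rightarrow> ('a \<Rightarrow> 'b) \<Rightarrow> 'b set \<Rightarrow> 'a set" where
  "spec_map S h Q = {s \<in> carrier S. h s \<in> Q}"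

text \<open>For \<open>f : S \<rightarrow> T'\<close> and \<open>g : S \<rightarrow> T\<close>, the map sending a closed subset \<open>Y\<close> of \<open>spec T\<close> to
  the inverse image under \<open>f\<^sup>\<circ>\<close> of the closure of \<open>g\<^sup>\<circ>(Y)\<close> in \<open>spec S\<close>.\<close>

definition spec_bar :: "('a, 'm) ring_scheme \<Rightarrow> ('b, 'n) ring_scheme \<Rightarrow> ('a \<Rightarrow> 'b) \<Rightarrow> ('a \<Rightarrow> 'c)
    \<Rightarrow> 'c set set \<Rightarrow> 'b set set" where
  "spec_bar S T' f g Y =
     {Q \<in> spec T'. spec_map S f Q \<in> spec_top S closure_of (spec_map S g ` Y)}"

lemma istopology_zariski:
  fixes A (structure)
  assumes A: "cring A" and X: "X \<subseteq> spec A"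
  shows "istopology (\<lambda>U. \<exists>I. ideal I A \<and> U = {P \<in> X. \<not> I \<subseteq> P})"
  unfolding istopology_def
proof (intro conjI allI impI)
  interpret cring A by (rule A)
  fix S T
  assume "\<exists>I. ideal I A \<and> S = {P \<in> X. \<not> I \<subseteq> P}" "\<exists>I. ideal I A \<and> T = {P \<in> X. \<not> I \<subseteq> P}"
  then obtain I I' where I: "ideal I A" "S = {P \<in> X. \<not> I \<subseteq> P}"
    and I': "ideal I' A" "T = {P \<in> X. \<not> I' \<subseteq> P}" by blast
  have "\<not> I \<inter> I' \<subseteq> P" if P: "P \<in> X" and n: "\<not> I \<subseteq> P" "\<not> I' \<subseteq> P" for P
  proof -
    interpret P: primeideal P A using P X by (auto simp: spec_def)
    obtain x y where xy: "x \<in> I" "x \<notin> P" "y \<in> I'" "y \<notin> P" using n by blast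
    have c: "x \<in> carrier A" "y \<in> carrier A"
      using xy I(1) I'(1) by (auto dest: ideal.Icarr)
    have "x \<otimes> y \<in> I \<inter> I'"
      using xy c I(1) I'(1) by (auto intro: ideal.I_l_closed ideal.I_r_closed)
    moreover have "x \<otimes> y \<notin> P" using P.I_prime c xy by blast
    ultimately show ?thesis by blast
  qed
  then have "S \<inter> T = {P \<in> X. \<not> I \<inter> I' \<subseteq> P}" using I I' by blast
  then show "\<exists>I. ideal I A \<and> S \<inter> T = {P \<in> X. \<not> I \<subseteq> P}"
    using i_intersect[OF I(1) I'(1)] by blast
next
  interpret cring A by (rule A)
  fix F
  assume "\<forall>K\<in>F. \<exists>I. ideal I A \<and> K = {P \<in> X. \<not> I \<subseteq> P}"
  then obtain f where f: "\<And>K. K \<in> F \<Longrightarrow> ideal (f K) A"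
      "\<And>K. K \<in> F \<Longrightarrow> K = {P \<in> X. \<not> f K \<subseteq> P}" by metis
  define I where "I = Idl (\<Union>(f ` F))"
  have sub: "\<Union>(f ` F) \<subseteq> carrier A" using f(1) by (auto dest: ideal.Icarr)
  have I: "ideal I A" unfolding I_def by (rule genideal_ideal[OF sub])
  have "I \<subseteq> P \<longleftrightarrow> (\<forall>K\<in>F. f K \<subseteq> P)" if "P \<in> X" for P
  proof -
    have P: "ideal P A" using that X by (auto simp: spec_def primeideal_def)
    have "I \<subseteq> P \<longleftrightarrow> \<Union>(f ` F) \<subseteq> P"
      unfolding I_def using genideal_self[OF sub] genideal_minimal[OF P] by blast
    then show ?thesis by blast
  qed
  moreover have "\<Union>F = {P \<in> X. \<exists>K\<in>F. \<not> f K \<subseteq> P}"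
  proof (intro Set.set_eqI iffI)
    fix P assume "P \<in> \<Union>F"
    then obtain K where K: "K \<in> F" "P \<in> K" by blast
    then have "P \<in> {P \<in> X. \<not> f K \<subseteq> P}" using f(2)[OF K(1)] by argo
    then show "P \<in> {P \<in> X. \<exists>K\<in>F. \<not> f K \<subseteq> P}" using K by blast
  next
    fix P assume "P \<in> {P \<in> X. \<exists>K\<in>F. \<not> f K \<subseteq> P}"
    then obtain K where K: "K \<in> F" "P \<in> {P \<in> X. \<not> f K \<subseteq> P}" by blast
    then have "P \<in> K" using f(2)[OF K(1)] by argo
    then show "P \<in> \<Union>F" using K by blast
  qed
  moreover have "{P \<in> X. \<exists>K\<in>F. \<not> f K \<subseteq> P} = {P \<in> X. \<not> I \<subseteq> P}"
    using calculation(1) by (intro Collect_cong conj_cong refl) meson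
  ultimately have "\<Union>F = {P \<in> X. \<not> I \<subseteq> P}" by argo
  then show "\<exists>I. ideal I A \<and> \<Union>F = {P \<in> X. \<not> I \<subseteq> P}" using I by blast
qed

lemma topspace_zariski:
  assumes "cring A" and "X \<subseteq> spec A"
  shows "topspace (zariski A X) = X"
proof -
  interpret cring A by fact
  have o: "openin (zariski A X) = (\<lambda>U. \<exists>I. ideal I A \<and> U = {P \<in> X. \<not> I \<subseteq> P})"
    unfolding zariski_def using istopology_zariski[OF assms] by (rule topology_inverse')
  have "X = {P \<in> X. \<not> carrier A \<subseteq> P}"
  proof -
    have "\<not> carrier A \<subseteq> P" if "P \<in> X" for P
    proof -
      interpret P: primeideal P A using that assms(2) by (auto simp: spec_def)
      show ?thesis using P.I_notcarr P.Icarr by auto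
    qed
    then show ?thesis by auto
  qed
  then have "openin (zariski A X) X" unfolding o using oneideal by blast
  moreover have "topspace (zariski A X) \<subseteq> X"
    using o unfolding topspace_def by auto
  ultimately show ?thesis using openin_subset by (metis subset_antisym)
qed

lemma closedin_zariski:
  assumes "cring A" and "X \<subseteq> spec A"
  shows "closedin (zariski A X) C \<longleftrightarrow> (\<exists>I. ideal I A \<and> C = {P \<in> X. I \<subseteq> P})"
proof -
  have o: "openin (zariski A X) = (\<lambda>U. \<exists>I. ideal I A \<and> U = {P \<in> X. \<not> I \<subseteq> P})"
    unfolding zariski_def using istopology_zariski[OF assms] by (rule topology_inverse')
  have "C \<subseteq> X \<and> X - C = {P \<in> X. \<not> I \<subseteq> P} \<longleftrightarrow> C = {P \<in> X. I \<subseteq> P}" for I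
    by auto
  note * = this
  have "closedin (zariski A X) C
      \<longleftrightarrow> (\<exists>I. ideal I A \<and> (C \<subseteq> X \<and> X - C = {P \<in> X. \<not> I \<subseteq> P}))"
    unfolding closedin_def topspace_zariski[OF assms] o by (rule iffI; elim conjE exE; intro conjI exI)
  then show ?thesis unfolding * .
qed


section \<open>The Poisson algebra of functions on \<open>GL\<^sub>2\<close>\<close>

subsection \<open>The coordinate ring\<close>

text \<open>The type \<open>'k mat_poly\<close> is the polynomial ring \<open>k[Y11, Y12, Y21, Y22]\<close>, with \<open>Y11\<close> the
  innermost and \<open>Y22\<close> the outermost variable; \<open>'k mat_fract\<close> is its field of fractions.\<close>

type_synonym 'k mat_poly = "'k poly poly poly poly"
type_synonym 'k mat_fract = "'k mat_poly fract"

definition Y11 :: "'k::field mat_poly" where "Y11 = [:[:[:[:0, 1:]:]:]:]"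
definition Y12 :: "'k::field mat_poly" where "Y12 = [:[:[:0, 1:]:]:]"
definition Y21 :: "'k::field mat_poly" where "Y21 = [:[:0, 1:]:]"
definition Y22 :: "'k::field mat_poly" where "Y22 = [:0, 1:]"

definition Det :: "'k::field mat_poly" where "Det = Y11 * Y22 - Y12 * Y21"

definition to_frac :: "'k::field mat_poly \<Rightarrow> 'k mat_fract" where "to_frac p = Fract p 1"

definition scalar :: "'k::field \<Rightarrow> 'k mat_fract" where "scalar c = to_frac [:[:[:[:c:]:]:]:]"

definition GL2 :: "'k::field mat_fract ring" where
  "GL2 = \<lparr>carrier = {Fract p (Det ^ n) | p n. True},
          mult = (*), one = 1, zero = 0, add = (+)\<rparr>"

lemma Det_nonzero: "Det \<noteq> (0 :: 'k::field mat_poly)"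
  by (simp add: Det_def Y11_def Y12_def Y21_def Y22_def)

lemma GL2_cring: "cring (GL2 :: 'k::field mat_fract ring)"
proof -
  have nz: "Det ^ n \<noteq> (0 :: 'k mat_poly)" for n by (simp add: Det_nonzero)
  have add: "\<exists>r l. Fract p (Det ^ n) + Fract q (Det ^ m) = Fract r (Det ^ l)"
    and mult: "\<exists>r l. Fract p (Det ^ n) * Fract q (Det ^ m) = Fract r (Det ^ l)"
    for p q :: "'k mat_poly" and n m
    using nz by (auto simp flip: power_add)
  have neg: "\<exists>r l. - Fract p (Det ^ n) = Fract r (Det ^ l)" for p :: "'k mat_poly" and n
    by (metis minus_fract)
  have 01: "\<exists>r l. 0 = Fract r (Det ^ l :: 'k mat_poly)" "\<exists>r l. 1 = Fract r (Det ^ l :: 'k mat_poly)"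
    by (metis Zero_fract_def power_0, metis One_fract_def power_0)
  show ?thesis
  proof (intro cringI abelian_groupI comm_monoidI)
    fix x :: "'k mat_fract" assume "x \<in> carrier GL2"
    then show "\<exists>y\<in>carrier GL2. y \<oplus>\<^bsub>GL2\<^esub> x = \<zero>\<^bsub>GL2\<^esub>"
      using neg by (intro bexI[of _ "- x"]) (auto simp: GL2_def)
  qed (use add mult 01 in \<open>auto simp: GL2_def algebra_simps\<close>)
qed

lemma GL2_closed:
  assumes "x \<in> carrier GL2" "y \<in> carrier GL2"
  shows "x + y \<in> carrier GL2" "x * y \<in> carrier GL2" "- x \<in> carrier GL2" "x - y \<in> carrier GL2"
proof -
  interpret cring "GL2 :: 'a mat_fract ring" by (rule GL2_cring)
  have 1: "x + y \<in> carrier GL2" if "x \<in> carrier GL2" "y \<in> carrier GL2" for x y :: "'a mat_fract"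
    using a_closed[OF that] by (simp add: GL2_def)
  have 2: "- x \<in> carrier GL2" if "x \<in> carrier GL2" for x :: "'a mat_fract"
    using that unfolding GL2_def by simp (metis minus_fract)
  show "x + y \<in> carrier GL2" "- x \<in> carrier GL2" by (fact 1[OF assms], fact 2[OF assms(1)])
  show "x * y \<in> carrier GL2" using m_closed[OF assms] by (simp add: GL2_def)
  show "x - y \<in> carrier GL2" using 1[OF assms(1) 2[OF assms(2)]] by simp
qed

lemma to_frac_in_GL2: "to_frac p \<in> carrier GL2"
  unfolding to_frac_def GL2_def by simp (metis power_0)

subsection \<open>The Poisson bracket\<close>

definition D11 :: "'k::field mat_poly \<Rightarrow> 'k mat_poly" where
  "D11 = map_poly (map_poly (map_poly pderiv))"
definition D12 :: "'k::field mat_poly \<Rightarrow> 'k mat_poly" where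
  "D12 = map_poly (map_poly pderiv)"
definition D21 :: "'k::field mat_poly \<Rightarrow> 'k mat_poly" where
  "D21 = map_poly pderiv"
definition D22 :: "'k::field mat_poly \<Rightarrow> 'k mat_poly" where
  "D22 = pderiv"

text \<open>The extension of a derivation to the field of fractions, by the quotient rule.\<close>

definition fract_deriv :: "('r::idom \<Rightarrow> 'r) \<Rightarrow> 'r fract \<Rightarrow> 'r fract" where
  "fract_deriv \<delta> x =
     (THE y. \<exists>p q. q \<noteq> 0 \<and> x = Fract p q \<and> y = Fract (\<delta> p * q - p * \<delta> q) (q * q))"

definition derivation :: "('r::idom \<Rightarrow> 'r) \<Rightarrow> bool" where
  "derivation \<delta> \<longleftrightarrow> (\<forall>p q. \<delta> (p + q) = \<delta> p + \<delta> q) \<and> (\<forall>p q. \<delta> (p * q) = \<delta> p * q + p * \<delta> q)"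

lemma derivation_0: "derivation \<delta> \<Longrightarrow> \<delta> 0 = 0"
  unfolding derivation_def by (metis add_cancel_right_right)

lemma derivation_1: "derivation \<delta> \<Longrightarrow> \<delta> 1 = 0"
  unfolding derivation_def by (metis add_cancel_right_right mult.right_neutral mult_1)

lemma derivation_sum: "derivation \<delta> \<Longrightarrow> \<delta> (sum f A) = (\<Sum>x\<in>A. \<delta> (f x))"
  by (induction A rule: infinite_finite_induct) (auto simp: derivation_0, auto simp: derivation_def)

lemma derivation_pderiv: "derivation (pderiv :: 'r::idom poly \<Rightarrow> _)"
  unfolding derivation_def by (auto simp: pderiv_add pderiv_mult algebra_simps)

lemma derivation_map_poly:
  assumes "derivation \<delta>" shows "derivation (map_poly \<delta>)"
proof -
  note d0 = derivation_0[OF assms]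
  have "map_poly \<delta> (p + q) = map_poly \<delta> p + map_poly \<delta> q" for p q
    using assms by (intro poly_eqI) (simp add: coeff_map_poly d0 derivation_def)
  moreover have "map_poly \<delta> (p * q) = map_poly \<delta> p * q + p * map_poly \<delta> q" for p q
    using assms
    by (intro poly_eqI)
      (simp add: coeff_map_poly d0 coeff_mult derivation_sum derivation_def sum.distrib)
  ultimately show ?thesis unfolding derivation_def by blast
qed

lemma fract_deriv_Fract:
  assumes d: "derivation \<delta>" and "q \<noteq> 0"
  shows "fract_deriv \<delta> (Fract p q) = Fract (\<delta> p * q - p * \<delta> q) (q * q)"
  unfolding fract_deriv_def
proof (rule the_equality)
  show "\<exists>p' q'. q' \<noteq> 0 \<and> Fract p q = Fract p' q' \<and>
      Fract (\<delta> p * q - p * \<delta> q) (q * q) = Fract (\<delta> p' * q' - p' * \<delta> q') (q' * q')"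
    using assms(2) by blast
next
  fix y assume "\<exists>p' q'. q' \<noteq> 0 \<and> Fract p q = Fract p' q' \<and>
      y = Fract (\<delta> p' * q' - p' * \<delta> q') (q' * q')"
  then obtain p' q' where *: "q' \<noteq> 0" "Fract p q = Fract p' q'"
      "y = Fract (\<delta> p' * q' - p' * \<delta> q') (q' * q')" by blast
  have e: "p * q' = p' * q" using * assms(2) by (simp add: eq_fract)
  then have "\<delta> (p * q') = \<delta> (p' * q)" by simp
  then have "\<delta> p * q' + p * \<delta> q' = \<delta> p' * q + p' * \<delta> q"
    using d unfolding derivation_def by simp
  then have "(\<delta> p' * q' - p' * \<delta> q') * (q * q) = (\<delta> p * q - p * \<delta> q) * (q' * q')"
  proof -
    assume "\<delta> p * q' + p * \<delta> q' = \<delta> p' * q + p' * \<delta> q"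
    then have 1: "\<delta> p' * q = \<delta> p * q' + p * \<delta> q' - p' * \<delta> q" by (simp add: algebra_simps)
    have "(\<delta> p' * q' - p' * \<delta> q') * (q * q) = (\<delta> p' * q) * q' * q - (p' * q) * \<delta> q' * q"
      by (simp add: algebra_simps)
    also have "\<dots> = (\<delta> p * q' + p * \<delta> q' - p' * \<delta> q) * q' * q - (p * q') * \<delta> q' * q"
      by (simp only: 1 e)
    also have "\<dots> = \<delta> p * q' * q' * q - (p' * q) * \<delta> q * q'"
      by (simp add: algebra_simps)
    also have "\<dots> = (\<delta> p * q - p * \<delta> q) * (q' * q')"
      by (simp only: e[symmetric]) (simp add: algebra_simps)
    finally show ?thesis .
  qed
  then show "y = Fract (\<delta> p * q - p * \<delta> q) (q * q)"
    using * assms(2) by (simp add: eq_fract)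
qed

lemma derivation_fract_deriv:
  assumes d: "derivation \<delta>" shows "derivation (fract_deriv \<delta>)"
proof -
  have "fract_deriv \<delta> (x + y) = fract_deriv \<delta> x + fract_deriv \<delta> y" for x y
  proof (cases x, cases y)
    fix a b c e assume "x = Fract a b" "b \<noteq> 0" "y = Fract c e" "e \<noteq> 0"
    then show ?thesis using d
      by (simp add: fract_deriv_Fract eq_fract) (simp add: derivation_def algebra_simps)
  qed
  moreover have "fract_deriv \<delta> (x * y) = fract_deriv \<delta> x * y + x * fract_deriv \<delta> y" for x y
  proof (cases x, cases y)
    fix a b c e assume "x = Fract a b" "b \<noteq> 0" "y = Fract c e" "e \<noteq> 0"
    then show ?thesis using d
      by (simp add: fract_deriv_Fract eq_fract) (simp add: derivation_def algebra_simps)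
  qed
  ultimately show ?thesis unfolding derivation_def by blast
qed

lemma derivation_D:
  "derivation D11" "derivation D12" "derivation D21" "derivation D22"
  unfolding D11_def D12_def D21_def D22_def
  by (simp_all add: derivation_map_poly derivation_pderiv)

text \<open>The Poisson bracket is the biderivation
  \<open>{x, y} = \<Sum>\<^sub>u\<^sub><\<^sub>v {u, v} (\<partial>x/\<partial>u \<partial>y/\<partial>v - \<partial>x/\<partial>v \<partial>y/\<partial>u)\<close>, the sum running over pairs of generators
  (the summand for \<open>{Y12, Y21} = 0\<close> is omitted). The lemmas \<open>GL2_br_gens\<close>, \<open>GL2_br_skew\<close>,
  \<open>GL2_br_add_left\<close>, \<open>GL2_br_mult_left\<close> and \<open>GL2_br_scalar\<close> below characterise it.\<close>

definition jac :: "('k::field mat_poly \<Rightarrow> 'k mat_poly) \<Rightarrow> ('k mat_poly \<Rightarrow> 'k mat_poly)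
    \<Rightarrow> 'k mat_fract \<Rightarrow> 'k mat_fract \<Rightarrow> 'k mat_fract" where
  "jac D D' x y = fract_deriv D x * fract_deriv D' y - fract_deriv D' x * fract_deriv D y"

definition GL2_br :: "'k::field mat_fract \<Rightarrow> 'k mat_fract \<Rightarrow> 'k mat_fract" where
  "GL2_br x y =
       to_frac (Y11 * Y12) * jac D11 D12 x y
     + to_frac (Y11 * Y21) * jac D11 D21 x y
     + to_frac (Y12 * Y22) * jac D12 D22 x y
     + to_frac (Y21 * Y22) * jac D21 D22 x y
     + to_frac (2 * Y12 * Y21) * jac D11 D22 x y"

lemma GL2_br_skew: "GL2_br x x = 0" "GL2_br y x = - GL2_br x y"
  by (simp_all add: GL2_br_def jac_def algebra_simps)

lemma GL2_br_add_left: "GL2_br (x + y) z = GL2_br x z + GL2_br y z"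
proof -
  note D = derivation_D[THEN derivation_fract_deriv, unfolded derivation_def, THEN conjunct1]
  show ?thesis unfolding GL2_br_def jac_def by (simp add: D algebra_simps)
qed

lemma GL2_br_mult_left: "GL2_br (x * y) z = GL2_br x z * y + x * GL2_br y z"
proof -
  note D = derivation_D[THEN derivation_fract_deriv, unfolded derivation_def, THEN conjunct2]
  show ?thesis unfolding GL2_br_def jac_def by (simp add: D algebra_simps)
qed

lemma fract_deriv_to_frac:
  "derivation \<delta> \<Longrightarrow> fract_deriv \<delta> (to_frac p) = to_frac (\<delta> p)"
  by (simp add: to_frac_def fract_deriv_Fract derivation_1)

lemmas D_defs = D11_def D12_def D21_def D22_def
lemmas Y_defs = Y11_def Y12_def Y21_def Y22_def

lemma GL2_br_scalar: "GL2_br (scalar c) x = 0"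
proof -
  have D: "D11 [:[:[:[:c:]:]:]:] = 0" "D12 [:[:[:[:c:]:]:]:] = 0"
    "D21 [:[:[:[:c:]:]:]:] = 0" "D22 [:[:[:[:c:]:]:]:] = 0"
    by (simp_all add: D_defs map_poly_pCons pderiv_pCons)
  have c: "to_frac 0 = 0" by (simp add: to_frac_def Zero_fract_def)
  show ?thesis
    by (simp add: GL2_br_def jac_def scalar_def fract_deriv_to_frac derivation_D D c)
qed

lemma GL2_br_gens:
  "GL2_br (to_frac Y11) (to_frac Y12) = to_frac (Y11 * Y12)"
  "GL2_br (to_frac Y11) (to_frac Y21) = to_frac (Y11 * Y21)"
  "GL2_br (to_frac Y12) (to_frac Y22) = to_frac (Y12 * Y22)"
  "GL2_br (to_frac Y21) (to_frac Y22) = to_frac (Y21 * Y22)"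
  "GL2_br (to_frac Y12) (to_frac Y21) = 0"
  "GL2_br (to_frac Y11) (to_frac Y22) = to_frac (2 * Y12 * Y21)"
proof -
  have D: "D11 Y11 = 1" "D11 Y12 = 0" "D11 Y21 = 0" "D11 Y22 = 0"
    "D12 Y11 = 0" "D12 Y12 = 1" "D12 Y21 = 0" "D12 Y22 = 0"
    "D21 Y11 = 0" "D21 Y12 = 0" "D21 Y21 = 1" "D21 Y22 = 0"
    "D22 Y11 = 0" "D22 Y12 = 0" "D22 Y21 = 0" "D22 Y22 = 1"
    unfolding D_defs Y_defs
    by (simp_all add: map_poly_pCons pderiv_pCons one_pCons)
  have c: "to_frac 0 = 0" "to_frac 1 = 1"
    by (simp_all add: to_frac_def Zero_fract_def One_fract_def)
  show
  "GL2_br (to_frac Y11) (to_frac Y12) = to_frac (Y11 * Y12)"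
  "GL2_br (to_frac Y11) (to_frac Y21) = to_frac (Y11 * Y21)"
  "GL2_br (to_frac Y12) (to_frac Y22) = to_frac (Y12 * Y22)"
  "GL2_br (to_frac Y21) (to_frac Y22) = to_frac (Y21 * Y22)"
  "GL2_br (to_frac Y12) (to_frac Y21) = 0"
  "GL2_br (to_frac Y11) (to_frac Y22) = to_frac (2 * Y12 * Y21)"
    by (simp_all add: GL2_br_def jac_def fract_deriv_to_frac derivation_D D c)
qed

lemma fract_deriv_in_GL2:
  assumes "derivation \<delta>" "x \<in> carrier GL2" shows "fract_deriv \<delta> x \<in> carrier GL2"
proof -
  obtain p n where x: "x = Fract p (Det ^ n)" using assms(2) by (auto simp: GL2_def)
  show ?thesis
    unfolding x by (subst fract_deriv_Fract[OF assms(1)])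
      (auto simp: GL2_def Det_nonzero simp flip: power_add)
qed

lemma GL2_br_closed:
  "x \<in> carrier GL2 \<Longrightarrow> y \<in> carrier GL2 \<Longrightarrow> GL2_br x y \<in> carrier GL2"
  unfolding GL2_br_def jac_def
  by (intro GL2_closed to_frac_in_GL2 fract_deriv_in_GL2 derivation_D)

subsection \<open>The torus action\<close>

definition torus :: "('k::field \<times> 'k \<times> 'k \<times> 'k) set" where
  "torus = {(\<alpha>1, \<alpha>2, \<beta>1, \<beta>2). \<alpha>1 \<noteq> 0 \<and> \<alpha>2 \<noteq> 0 \<and> \<beta>1 \<noteq> 0 \<and> \<beta>2 \<noteq> 0}"

text \<open>\<open>scale \<phi> c\<close> applies \<open>\<phi>\<close> to the coefficients and replaces the variable \<open>X\<close> by \<open>c X\<close>.\<close>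

definition scale :: "('r::idom \<Rightarrow> 'r) \<Rightarrow> 'r \<Rightarrow> 'r poly \<Rightarrow> 'r poly" where
  "scale \<phi> c p = pcompose (map_poly \<phi> p) [:0, c:]"

fun poly_act :: "'k::field \<times> 'k \<times> 'k \<times> 'k \<Rightarrow> 'k mat_poly \<Rightarrow> 'k mat_poly" where
  "poly_act (\<alpha>1, \<alpha>2, \<beta>1, \<beta>2) =
     scale (scale (scale (scale id (\<alpha>1 * \<beta>1)) [:\<alpha>1 * \<beta>2:]) [:[:\<alpha>2 * \<beta>1:]:]) [:[:[:\<alpha>2 * \<beta>2:]:]:]"

definition act :: "'k::field \<times> 'k \<times> 'k \<times> 'k \<Rightarrow> 'k mat_fract \<Rightarrow> 'k mat_fract" where
  "act h x = (THE y. \<exists>p q. q \<noteq> 0 \<and> x = Fract p q \<and> y = Fract (poly_act h p) (poly_act h q))"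

definition inj_hom :: "('r::idom \<Rightarrow> 'r) \<Rightarrow> bool" where
  "inj_hom \<phi> \<longleftrightarrow> \<phi> 1 = 1 \<and> (\<forall>p q. \<phi> (p + q) = \<phi> p + \<phi> q) \<and> (\<forall>p q. \<phi> (p * q) = \<phi> p * \<phi> q)
     \<and> (\<forall>p. \<phi> p = 0 \<longleftrightarrow> p = 0)"

lemma inj_hom_sum: "inj_hom \<phi> \<Longrightarrow> \<phi> (sum f A) = (\<Sum>x\<in>A. \<phi> (f x))"
  by (induction A rule: infinite_finite_induct) (auto simp: inj_hom_def)

lemma coeff_scale: "inj_hom \<phi> \<Longrightarrow> coeff (scale \<phi> c p) n = c ^ n * \<phi> (coeff p n)"
  by (simp add: scale_def coeff_pcompose_linear coeff_map_poly inj_hom_def)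

lemma inj_hom_scale:
  assumes \<phi>: "inj_hom \<phi>" and "c \<noteq> 0" shows "inj_hom (scale \<phi> c)"
proof -
  have "scale \<phi> c 1 = 1"
    using \<phi> by (intro poly_eqI) (auto simp: coeff_scale inj_hom_def one_pCons coeff_pCons
        split: nat.splits)
  moreover have "scale \<phi> c (p + q) = scale \<phi> c p + scale \<phi> c q" for p q
    using \<phi> by (intro poly_eqI) (simp add: coeff_scale inj_hom_def algebra_simps)
  moreover have "scale \<phi> c (p * q) = scale \<phi> c p * scale \<phi> c q" for p q
  proof (intro poly_eqI)
    fix n
    have m: "\<phi> (x * y) = \<phi> x * \<phi> y" for x y using \<phi> by (simp add: inj_hom_def)
    have "c ^ n * (\<phi> (coeff p i) * \<phi> (coeff q (n - i)))
        = (c ^ i * \<phi> (coeff p i)) * (c ^ (n - i) * \<phi> (coeff q (n - i)))" if "i \<le> n" for i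
    proof -
      have "c ^ n = c ^ i * c ^ (n - i)" using that by (simp flip: power_add)
      then show ?thesis by simp
    qed
    then have "(\<Sum>i\<le>n. c ^ n * (\<phi> (coeff p i) * \<phi> (coeff q (n - i))))
        = (\<Sum>i\<le>n. (c ^ i * \<phi> (coeff p i)) * (c ^ (n - i) * \<phi> (coeff q (n - i))))"
      by (intro sum.cong) (auto simp del: mult_cancel_left mult_cancel_right)
    then show "coeff (scale \<phi> c (p * q)) n = coeff (scale \<phi> c p * scale \<phi> c q) n"
      by (simp only: coeff_scale[OF \<phi>] coeff_mult inj_hom_sum[OF \<phi>] sum_distrib_left m)
  qed
  moreover have "scale \<phi> c p = 0 \<longleftrightarrow> p = 0" for p
    using assms by (auto simp: poly_eq_iff coeff_scale inj_hom_def)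
  ultimately show ?thesis unfolding inj_hom_def by blast
qed

lemma scale_const: "inj_hom \<phi> \<Longrightarrow> scale \<phi> c [:x:] = [:\<phi> x:]"
  by (intro poly_eqI) (auto simp: coeff_scale coeff_pCons inj_hom_def split: nat.splits)

lemma scale_X: "inj_hom \<phi> \<Longrightarrow> scale \<phi> c [:0, 1:] = [:0, c:]"
  by (intro poly_eqI) (auto simp: coeff_scale coeff_pCons inj_hom_def split: nat.splits)

lemma inj_hom_poly_act:
  assumes "h \<in> torus" shows "inj_hom (poly_act h)"
proof -
  have "inj_hom id" by (simp add: inj_hom_def)
  then show ?thesis using assms unfolding torus_def
    by (auto simp del: id_apply intro!: inj_hom_scale)
qed

lemma act_Fract:
  assumes h: "h \<in> torus" and "q \<noteq> 0"
  shows "act h (Fract p q) = Fract (poly_act h p) (poly_act h q)"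
  unfolding act_def
proof (rule the_equality)
  show "\<exists>p' q'. q' \<noteq> 0 \<and> Fract p q = Fract p' q' \<and>
      Fract (poly_act h p) (poly_act h q) = Fract (poly_act h p') (poly_act h q')"
    using assms(2) by blast
next
  note i = inj_hom_poly_act[OF h, unfolded inj_hom_def]
  fix y assume "\<exists>p' q'. q' \<noteq> 0 \<and> Fract p q = Fract p' q' \<and> y = Fract (poly_act h p') (poly_act h q')"
  then obtain p' q' where *: "q' \<noteq> 0" "Fract p q = Fract p' q'"
      "y = Fract (poly_act h p') (poly_act h q')" by blast
  have "p * q' = p' * q" using * assms(2) by (simp add: eq_fract)
  then have "poly_act h p * poly_act h q' = poly_act h p' * poly_act h q" using i by metis
  then show "y = Fract (poly_act h p) (poly_act h q)"
    using * assms(2) i by (simp add: eq_fract)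
qed

lemma act_hom:
  assumes h: "h \<in> torus"
  shows "act h (x + y) = act h x + act h y" "act h (x * y) = act h x * act h y"
proof -
  note i = inj_hom_poly_act[OF h, unfolded inj_hom_def]
  obtain a b c e where "x = Fract a b" "b \<noteq> 0" "y = Fract c e" "e \<noteq> 0"
    by (metis Fract_cases)
  then show "act h (x + y) = act h x + act h y" "act h (x * y) = act h x * act h y"
    using i by (simp_all add: act_Fract[OF h])
qed

lemma act_scalar: "h \<in> torus \<Longrightarrow> act h (scalar c) = scalar c"
  by (cases h)
    (simp add: scalar_def to_frac_def act_Fract inj_hom_poly_act[unfolded inj_hom_def]
      del: poly_act.simps, simp add: scale_def map_poly_pCons pcompose_pCons)

lemma act_gens:
  assumes h: "(\<alpha>1, \<alpha>2, \<beta>1, \<beta>2) \<in> torus"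
  shows "act (\<alpha>1, \<alpha>2, \<beta>1, \<beta>2) (to_frac Y11) = scalar (\<alpha>1 * \<beta>1) * to_frac Y11"
    "act (\<alpha>1, \<alpha>2, \<beta>1, \<beta>2) (to_frac Y12) = scalar (\<alpha>1 * \<beta>2) * to_frac Y12"
    "act (\<alpha>1, \<alpha>2, \<beta>1, \<beta>2) (to_frac Y21) = scalar (\<alpha>2 * \<beta>1) * to_frac Y21"
    "act (\<alpha>1, \<alpha>2, \<beta>1, \<beta>2) (to_frac Y22) = scalar (\<alpha>2 * \<beta>2) * to_frac Y22"
proof -
  note i = inj_hom_poly_act[OF h, unfolded inj_hom_def]
  have i0: "inj_hom (id :: 'a \<Rightarrow> 'a)" by (simp add: inj_hom_def)
  have e: "act (\<alpha>1, \<alpha>2, \<beta>1, \<beta>2) (to_frac p) = to_frac (poly_act (\<alpha>1, \<alpha>2, \<beta>1, \<beta>2) p)" for p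
    using i by (simp add: to_frac_def act_Fract[OF h] del: poly_act.simps)
  show "act (\<alpha>1, \<alpha>2, \<beta>1, \<beta>2) (to_frac Y11) = scalar (\<alpha>1 * \<beta>1) * to_frac Y11"
    "act (\<alpha>1, \<alpha>2, \<beta>1, \<beta>2) (to_frac Y12) = scalar (\<alpha>1 * \<beta>2) * to_frac Y12"
    "act (\<alpha>1, \<alpha>2, \<beta>1, \<beta>2) (to_frac Y21) = scalar (\<alpha>2 * \<beta>1) * to_frac Y21"
    "act (\<alpha>1, \<alpha>2, \<beta>1, \<beta>2) (to_frac Y22) = scalar (\<alpha>2 * \<beta>2) * to_frac Y22"
    using h unfolding e
    by (simp_all add: torus_def scalar_def to_frac_def Y_defs scale_X scale_const inj_hom_scale i0
        del: id_apply)
qed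

lemma act_closed:
  assumes h: "h \<in> torus" and x: "x \<in> carrier GL2"
  shows "act h x \<in> carrier GL2"
proof -
  obtain \<alpha>1 \<alpha>2 \<beta>1 \<beta>2 where h': "h = (\<alpha>1, \<alpha>2, \<beta>1, \<beta>2)" by (cases h)
  obtain p n where x': "x = Fract p (Det ^ n)" using x by (auto simp: GL2_def)
  define e where "e = \<alpha>1 * \<alpha>2 * \<beta>1 * \<beta>2"
  have "e \<noteq> 0" using h by (simp add: h' torus_def e_def)
  have f: "to_frac (a * b) = to_frac a * to_frac b" "to_frac (a - b) = to_frac a - to_frac b"
    for a b :: "'a mat_poly" by (simp_all add: to_frac_def)
  have s: "scalar (a * b) = scalar a * scalar b" "scalar 1 = 1" for a b :: 'a
    by (simp_all add: scalar_def to_frac_def One_fract_def one_pCons)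
  have "act h (to_frac Det) + act h (to_frac (Y12 * Y21)) = act h (to_frac (Y11 * Y22))"
    by (simp add: Det_def f flip: act_hom[OF h])
  then have D: "act h (to_frac Det) = scalar e * to_frac Det"
    using h unfolding h'
    by (simp add: f act_hom act_gens s e_def Det_def algebra_simps)
  have pow: "act h (y ^ m) = act h y ^ m" for y m
    using act_scalar[OF h, of 1] by (induction m) (simp_all add: act_hom[OF h] s)
  have fp: "to_frac (a ^ m) = to_frac a ^ m" for a :: "'a mat_poly" and m
    by (induction m) (simp_all add: f, simp add: to_frac_def One_fract_def)
  have "x * to_frac Det ^ n = to_frac p"
    unfolding fp[symmetric] by (simp add: x' to_frac_def Det_nonzero eq_fract)
  then have "act h x * (scalar e * to_frac Det) ^ n = act h (to_frac p)"
    by (metis act_hom(2)[OF h] D pow)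
  moreover have "scalar e * scalar (inverse e) = 1"
    using \<open>e \<noteq> 0\<close> by (simp flip: s)
  ultimately have "act h x * to_frac Det ^ n = act h (to_frac p) * scalar (inverse e) ^ n"
    by (metis (no_types, lifting) mult.assoc mult.commute mult.right_neutral power_mult_distrib
        power_one)
  moreover have "act h (to_frac p) = to_frac (poly_act h p)"
    using inj_hom_poly_act[OF h] by (simp add: to_frac_def act_Fract[OF h] inj_hom_def)
  ultimately have "act h x * to_frac (Det ^ n)
      = to_frac (poly_act h p * [:[:[:[:inverse e:]:]:]:] ^ n)"
    by (simp add: fp f scalar_def)
  then have "act h x = Fract (poly_act h p * [:[:[:[:inverse e:]:]:]:] ^ n) (Det ^ n)"
    by (cases "act h x") (simp add: to_frac_def eq_fract Det_nonzero)
  then show ?thesis by (auto simp: GL2_def)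
qed

subsection \<open>Poisson \<open>H\<close>-primes and strata\<close>

definition poisson_H_prime :: "'k::field mat_fract set \<Rightarrow> bool" where
  "poisson_H_prime J \<longleftrightarrow> J \<in> pspec GL2 GL2_br \<and> (\<forall>h\<in>torus. act h ` J = J)"

definition stratum :: "'k::field mat_fract set \<Rightarrow> 'k mat_fract set set" where
  "stratum J = {P \<in> pspec GL2 GL2_br. (\<Inter>h\<in>torus. act h ` P) = J}"

definition stratum_top :: "'k::field mat_fract set \<Rightarrow> 'k mat_fract set topology" where
  "stratum_top J = subtopology (pspec_top GL2 GL2_br) (stratum J)"

text \<open>For an \<open>H\<close>-invariant ideal \<open>J\<close>, the induced action on \<open>R / J\<close> is the image of cosets:
  \<open>h (x + J) = {h y | y \<in> x + J}\<close>. A homogeneous element is a nonzero simultaneous eigenvector.\<close>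

definition homogeneous :: "'k::field mat_fract set \<Rightarrow> 'k mat_fract set \<Rightarrow> bool" where
  "homogeneous J X \<longleftrightarrow> X \<in> carrier (GL2 Quot J) \<and> X \<noteq> \<zero>\<^bsub>GL2 Quot J\<^esub> \<and>
     (\<forall>h\<in>torus. \<exists>c. act h ` X = (J +>\<^bsub>GL2\<^esub> scalar c) \<otimes>\<^bsub>GL2 Quot J\<^esub> X)"

definition E :: "'k::field mat_fract set \<Rightarrow> 'k mat_fract set set" where
  "E J = {X. homogeneous J X}"

definition E2 :: "'k::field mat_fract set \<Rightarrow> 'k mat_fract set \<Rightarrow> 'k mat_fract set set" where
  "E2 J K = {X. homogeneous J X \<and> X \<notin> ideal_quot GL2 J K}"

text \<open>The elements of \<open>(R/J)[S\<^sup>-\<^sup>1]\<close> are sets of pairs of cosets.\<close>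

type_synonym 'k loc_elt = "('k mat_fract set \<times> 'k mat_fract set) set"

definition PZ :: "'k::field mat_fract set \<Rightarrow> 'k loc_elt ring" where
  "PZ J = pcentre (loc_ring (GL2 Quot J) (E J)) (loc_br (GL2 Quot J) (quot_br GL2 GL2_br J) (E J))"

definition PZ2 :: "'k::field mat_fract set \<Rightarrow> 'k mat_fract set \<Rightarrow> 'k loc_elt ring" where
  "PZ2 J K = pcentre (loc_ring (GL2 Quot J) (E2 J K))
     (loc_br (GL2 Quot J) (quot_br GL2 GL2_br J) (E2 J K))"

text \<open>The homeomorphism \<open>P \<mapsto> (P/J) R\<^sub>J \<inter> PZ(R\<^sub>J)\<close> from \<open>stratum J\<close> to \<open>spec (PZ J)\<close>.\<close>

definition stratum_map :: "'k::field mat_fract set \<Rightarrow> 'k mat_fract set \<Rightarrow> 'k loc_elt set" where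
  "stratum_map J P = loc_ext (GL2 Quot J) (E J) (ideal_quot GL2 J P) \<inter> carrier (PZ J)"

subsection \<open>The two maps between closed sets of strata\<close>

text \<open>Maps with domain \<open>CL (stratum_top J)\<close> are represented as extensional functions.\<close>

definition phi :: "'k::field mat_fract set \<Rightarrow> 'k mat_fract set
    \<Rightarrow> 'k mat_fract set set \<Rightarrow> 'k mat_fract set set" where
  "phi J K = (\<lambda>Y\<in>CL (stratum_top J). (pspec_top GL2 GL2_br closure_of Y) \<inter> stratum K)"

definition f_map :: "'k::field mat_fract set \<Rightarrow> 'k loc_elt \<Rightarrow> 'k loc_elt" where
  "f_map K = loc_map (GL2 Quot K) (E K) (quot_proj GL2 K)"

text \<open>The inclusion of \<open>(R/J)[E\<^sub>J\<^sub>K\<^sup>-\<^sup>1]\<close> into \<open>(R/J)[E\<^sub>J\<^sup>-\<^sup>1]\<close> is \<open>a/s \<mapsto> a/s\<close>; it is not the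
  identity on equivalence classes.\<close>

definition g_map :: "'k::field mat_fract set \<Rightarrow> 'k loc_elt \<Rightarrow> 'k loc_elt" where
  "g_map J = loc_map (GL2 Quot J) (E J) id"

text \<open>The map induced by \<open>f\<close> and \<open>g\<close>, transported to the strata along the bijections
  \<open>stratum_map J\<close> and \<open>stratum_map K\<close>.\<close>

definition fg_bar :: "'k::field mat_fract set \<Rightarrow> 'k mat_fract set
    \<Rightarrow> 'k mat_fract set set \<Rightarrow> 'k mat_fract set set" where
  "fg_bar J K = (\<lambda>Y\<in>CL (stratum_top J).
     {P \<in> stratum K. stratum_map K P \<in>
        spec_bar (PZ2 J K) (PZ K) (f_map K) (g_map J) (stratum_map J ` Y)})"

end

theory Submission
  imports Defs "HOL-Algebra.Subrings"
begin

text \<open>Let \<open>P\<close> be in the stratum of \<open>K\<close>, \<open>Y\<close> a set of primes in the stratum of \<open>J\<close> and \<open>I = \<Inter>Y\<close>.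
  Elements of the strata avoid the denominators, so \<open>P\<close> belongs to the left-hand side iff
  \<open>I \<subseteq> P\<close>, and to the right-hand side iff \<open>w \<in> P\<close> for every \<open>w \<in> I\<close> that is the numerator of a
  Poisson central fraction with denominator in \<open>E\<^sub>J\<^sub>K\<close>. Hence one has to find such a \<open>w \<notin> P\<close> when
  \<open>I\<close> is not contained in \<open>P\<close>.

  As \<open>d = (D + b c) / a\<close>, every element of \<open>R\<close> is, up to a power of \<open>a\<close>, a sum of terms
  \<open>z a\<^sup>i c\<^sup>r\<close> with \<open>z\<close> in the span of the \<open>D\<^sup>m (b/c)\<^sup>j\<close>, which Poisson commute with everything. These terms
  are eigenvectors of \<open>{a, -}\<close> with weight \<open>r\<close> and of \<open>{b, -}\<close>, \<open>{c, -}\<close> with weight \<open>-i\<close>. If \<open>b\<close> or \<open>c\<close>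
  is not in \<open>J\<close>, then it is in no \<open>Q \<in> Y\<close>, nor is \<open>a\<close>, so each term of an element of \<open>I\<close> lies in \<open>I\<close>.
  Some term is not in \<open>P\<close>; dividing it by \<open>a\<^sup>i c\<^sup>r\<close> or \<open>a\<^sup>i b\<^sup>r\<close> makes it central. If both \<open>b\<close> and \<open>c\<close> are in
  \<open>K\<close>, such a term has \<open>r = 0\<close>. If \<open>b\<close> and \<open>c\<close> are in \<open>J\<close>, the bracket of \<open>R / J\<close> is zero.\<close>

section \<open>Functions on \<open>GL\<^sub>2\<close> and their brackets\<close>

lemma to_frac_simps:
  "to_frac (p + q) = to_frac p + to_frac q" "to_frac (p - q) = to_frac p - to_frac q"
  "to_frac (p * q) = to_frac p * to_frac q" "to_frac 0 = 0" "to_frac 1 = 1"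
  by (simp_all add: to_frac_def Zero_fract_def One_fract_def)

lemma to_frac_power: "to_frac (p ^ n) = to_frac p ^ n"
  by (induction n) (simp_all add: to_frac_simps)

lemma to_frac_eq_0_iff: "to_frac p = 0 \<longleftrightarrow> p = 0"
  by (simp add: to_frac_def Zero_fract_def eq_fract)

lemma Fract_to_frac: "q \<noteq> 0 \<Longrightarrow> Fract p q = to_frac p / to_frac q"
  by (simp add: to_frac_def)

lemma scalar_simps: "scalar (x * y) = scalar x * scalar y" "scalar 1 = 1"
  by (simp_all add: scalar_def to_frac_def One_fract_def one_pCons)

text \<open>Horner's scheme, one variable at a time from the innermost outwards:
  \<open>pCons a p\<close> is \<open>a\<close> plus the variable times \<open>p\<close>, and
  \<open>a\<close> is covered by the preceding layer.\<close>

lemma mat_poly_induct: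
  fixes Q :: "'k::field mat_poly \<Rightarrow> bool"
  assumes const: "\<And>x. Q [:[:[:[:x:]:]:]:]"
    and add: "\<And>p q. Q p \<Longrightarrow> Q q \<Longrightarrow> Q (p + q)"
    and Y: "\<And>p. Q p \<Longrightarrow> Q (Y11 * p)" "\<And>p. Q p \<Longrightarrow> Q (Y12 * p)"
      "\<And>p. Q p \<Longrightarrow> Q (Y21 * p)" "\<And>p. Q p \<Longrightarrow> Q (Y22 * p)"
  shows "Q p"
proof -
  have 0: "Q 0" using const[of 0] by simp
  have 1: "Q [:[:[:p:]:]:]" for p
  proof (induction p)
    case (pCons a p)
    show ?case using add[OF const[of a] Y(1)[OF pCons(2)]] by (simp add: Y11_def)
  qed (simp add: 0)
  have 2: "Q [:[:p:]:]" for p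
  proof (induction p)
    case (pCons a p)
    show ?case using add[OF 1[of a] Y(2)[OF pCons(2)]] by (simp add: Y12_def)
  qed (simp add: 0)
  have 3: "Q [:p:]" for p
  proof (induction p)
    case (pCons a p)
    show ?case using add[OF 2[of a] Y(3)[OF pCons(2)]] by (simp add: Y21_def)
  qed (simp add: 0)
  show ?thesis
  proof (induction p)
    case (pCons a p)
    show ?case using add[OF 3[of a] Y(4)[OF pCons(2)]] by (simp add: Y22_def)
  qed (simp add: 0)
qed

abbreviation ya :: "'k::field mat_fract" where "ya \<equiv> to_frac Y11"
abbreviation yb :: "'k::field mat_fract" where "yb \<equiv> to_frac Y12"
abbreviation yc :: "'k::field mat_fract" where "yc \<equiv> to_frac Y21"
abbreviation yd :: "'k::field mat_fract" where "yd \<equiv> to_frac Y22"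
abbreviation yD :: "'k::field mat_fract" where "yD \<equiv> to_frac Det"

lemma gens_nonzero: "ya \<noteq> 0" "yb \<noteq> 0" "yc \<noteq> 0" "yd \<noteq> 0" "yD \<noteq> 0"
  by (simp_all add: to_frac_eq_0_iff Det_nonzero) (simp_all add: Y_defs)

lemma yD_eq: "yD = ya * yd - yb * yc"
  by (simp add: Det_def to_frac_simps)

lemma inverse_yD_in_GL2: "inverse yD \<in> carrier GL2"
proof -
  have "inverse yD = Fract 1 (Det ^ 1)" by (simp add: to_frac_def)
  then have "\<exists>p n. inverse yD = Fract p (Det ^ n)" by blast
  then show ?thesis by (simp add: GL2_def)
qed

lemma scalar_in_GL2: "scalar x \<in> carrier GL2"
  by (simp add: scalar_def to_frac_in_GL2)

text \<open>Every element is \<open>p / D^n\<close>, so scalars, the four coordinates and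
  \<open>D^-1\<close> generate. Multiplying by one generator at a time keeps the induction steps
  linear in \<open>x\<close>.\<close>

lemma GL2_induct [consumes 1]:
  fixes Q :: "'k::field mat_fract \<Rightarrow> bool"
  assumes x: "x \<in> carrier GL2"
    and scalar: "\<And>x. Q (scalar x)"
    and add: "\<And>x y. Q x \<Longrightarrow> Q y \<Longrightarrow> Q (x + y)"
    and mult: "\<And>x. Q x \<Longrightarrow> Q (ya * x)" "\<And>x. Q x \<Longrightarrow> Q (yb * x)"
      "\<And>x. Q x \<Longrightarrow> Q (yc * x)" "\<And>x. Q x \<Longrightarrow> Q (yd * x)" "\<And>x. Q x \<Longrightarrow> Q (inverse yD * x)"
  shows "Q x"
proof -
  obtain p n where x: "x = Fract p (Det ^ n)" using x by (auto simp: GL2_def)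
  have "Q (to_frac p)"
    by (induction p rule: mat_poly_induct)
      (use scalar in \<open>simp_all add: add mult to_frac_simps scalar_def\<close>)
  then have "Q (inverse yD ^ n * to_frac p)"
    by (induction n) (simp_all add: mult mult.assoc)
  moreover have "x = inverse yD ^ n * to_frac p"
    unfolding x by (simp add: Fract_to_frac Det_nonzero to_frac_power field_simps gens_nonzero)
  ultimately show ?thesis by simp
qed

section \<open>Bracket calculus and Casimir elements\<close>

lemma GL2_br_add_right: "GL2_br z (x + y) = GL2_br z x + GL2_br z y"
  using GL2_br_add_left[of x y z] by (simp add: GL2_br_skew(2)[of z])

lemma GL2_br_mult_right: "GL2_br z (x * y) = GL2_br z x * y + x * GL2_br z y"
  using GL2_br_mult_left[of x y z] by (simp add: GL2_br_skew(2)[of z])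

lemma GL2_br_zero: "GL2_br 0 z = 0" "GL2_br z 0 = 0"
  using GL2_br_mult_left[of 0 0 z] GL2_br_mult_right[of z 0 0] by simp_all

lemma GL2_br_one: "GL2_br 1 z = 0" "GL2_br z 1 = 0"
  using GL2_br_scalar[of 1 z] GL2_br_skew(2)[of z 1] by (simp_all add: scalar_simps)

lemma GL2_br_minus: "GL2_br (- x) z = - GL2_br x z" "GL2_br z (- x) = - GL2_br z x"
  using GL2_br_add_left[of x "- x" z] GL2_br_add_right[of z x "- x"]
  by (simp_all add: GL2_br_zero add_eq_0_iff)

lemma GL2_br_diff: "GL2_br (x - y) z = GL2_br x z - GL2_br y z"
    "GL2_br z (x - y) = GL2_br z x - GL2_br z y"
  using GL2_br_add_left[of x "- y" z] GL2_br_add_right[of z x "- y"]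
  by (simp_all add: GL2_br_minus)

lemma GL2_br_sum_right: "GL2_br z (sum f A) = (\<Sum>x\<in>A. GL2_br z (f x))"
  by (induction A rule: infinite_finite_induct) (simp_all add: GL2_br_zero GL2_br_add_right)

text \<open>Both brackets are the generator times one and the same derivation,
  \<open>d \<partial>/\<partial>d - a \<partial>/\<partial>a\<close>. This is what makes
  \<open>b / c\<close> central.\<close>

lemma GL2_br_gen_left:
  "GL2_br yb y = yb * (yd * fract_deriv D22 y - ya * fract_deriv D11 y)"
  "GL2_br yc y = yc * (yd * fract_deriv D22 y - ya * fract_deriv D11 y)"
proof -
  have D: "D11 Y12 = 0" "D11 Y21 = 0" "D12 Y12 = 1" "D12 Y21 = 0"
    "D21 Y12 = 0" "D21 Y21 = 1" "D22 Y12 = 0" "D22 Y21 = 0"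
    unfolding D_defs Y_defs by (simp_all add: map_poly_pCons pderiv_pCons one_pCons)
  show "GL2_br yb y = yb * (yd * fract_deriv D22 y - ya * fract_deriv D11 y)"
    "GL2_br yc y = yc * (yd * fract_deriv D22 y - ya * fract_deriv D11 y)"
    by (simp_all add: GL2_br_def jac_def fract_deriv_to_frac derivation_D D to_frac_simps
        algebra_simps)
qed

text \<open>Centrality is taken in the whole fraction field, because the elements needed, such as
  \<open>b / c\<close>, lie outside \<open>GL2\<close>.\<close>

definition casimir :: "'k::field mat_fract \<Rightarrow> bool" where
  "casimir z \<longleftrightarrow> (\<forall>y. GL2_br z y = 0)"

lemma casimir_simps:
  "casimir 0" "casimir (scalar x)"
  "casimir y \<Longrightarrow> casimir z \<Longrightarrow> casimir (y + z)"
  "casimir y \<Longrightarrow> casimir z \<Longrightarrow> casimir (y * z)"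
  by (simp_all add: casimir_def GL2_br_zero GL2_br_scalar GL2_br_add_left GL2_br_mult_left)

lemma casimir_power: "casimir z \<Longrightarrow> casimir (z ^ n)"
  by (induction n) (auto simp: casimir_simps casimir_simps(2)[of 1, unfolded scalar_simps])

text \<open>The hypothesis says that the numerator of \<open>{x / z, y}\<close> in the quotient rule
  vanishes: \<open>x\<close> and \<open>z\<close> have the same logarithmic derivative under
  \<open>{-, y}\<close>.\<close>

lemma casimir_divide:
  assumes "z \<noteq> 0" and e: "\<And>y. GL2_br x y * z = x * GL2_br z y"
  shows "casimir (x / z)"
  unfolding casimir_def
proof
  fix y
  have "GL2_br x y = GL2_br (x / z) y * z + (x / z) * GL2_br z y"
    using GL2_br_mult_left[of "x / z" z y] assms(1) by simp
  then have "GL2_br (x / z) y * z = 0" using e[of y] assms(1) by (simp add: field_simps)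
  then show "GL2_br (x / z) y = 0" using assms(1) by simp
qed

lemma casimir_inverse: "casimir z \<Longrightarrow> casimir (inverse z)"
  using casimir_divide[of z 1] by (cases "z = 0")
    (auto simp: casimir_simps inverse_eq_divide casimir_def GL2_br_one)

lemma casimir_yb_yc: "casimir (yb / yc)" "casimir (yc / yb)"
  by (rule casimir_divide; simp add: gens_nonzero GL2_br_gen_left)+

lemma casimir_yD: "casimir yD"
proof -
  have D: "D11 Y11 = 1" "D11 Y12 = 0" "D11 Y21 = 0" "D11 Y22 = 0"
    "D12 Y11 = 0" "D12 Y12 = 1" "D12 Y21 = 0" "D12 Y22 = 0"
    "D21 Y11 = 0" "D21 Y12 = 0" "D21 Y21 = 1" "D21 Y22 = 0"
    "D22 Y11 = 0" "D22 Y12 = 0" "D22 Y21 = 0" "D22 Y22 = 1"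
    unfolding D_defs Y_defs
    by (simp_all add: map_poly_pCons pderiv_pCons one_pCons)
  have 2: "to_frac 2 = 2" by (metis one_add_one to_frac_simps(1,5))
  \<comment> \<open>The Hamiltonian derivations of \<open>a\<close> and \<open>d\<close>; with those
    of \<open>b\<close> and \<open>c\<close>, the Leibniz rule applied to \<open>a d - b c\<close>
    cancels term by term.\<close>
  have a: "GL2_br ya y = ya * yb * fract_deriv D12 y + ya * yc * fract_deriv D21 y
      + 2 * yb * yc * fract_deriv D22 y" for y
    by (simp add: GL2_br_def jac_def fract_deriv_to_frac derivation_D D to_frac_simps 2)
  have d: "GL2_br yd y = - yb * yd * fract_deriv D12 y - yc * yd * fract_deriv D21 y
      - 2 * yb * yc * fract_deriv D11 y" for y
    by (simp add: GL2_br_def jac_def fract_deriv_to_frac derivation_D D to_frac_simps 2)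
  show ?thesis
    unfolding casimir_def yD_eq
    by (simp add: GL2_br_diff GL2_br_mult_left a d GL2_br_gen_left algebra_simps)
qed

section \<open>Weight decomposition\<close>

text \<open>Eigenvectors of \<open>{a, -}\<close>, \<open>{b, -}\<close> and \<open>{c, -}\<close>, see \<open>wt_eigen\<close>. The last conjunct does not follow from
  the second one, as \<open>z\<close> may be \<open>b / c\<close>.\<close>

definition wt :: "nat \<Rightarrow> nat \<Rightarrow> 'k::field mat_fract \<Rightarrow> bool" where
  "wt i r w \<longleftrightarrow> w \<in> carrier GL2 \<and> (\<exists>z. casimir z \<and> w = z * ya ^ i * yc ^ r) \<and>
     (r > 0 \<longrightarrow> (\<exists>x\<in>carrier GL2. \<exists>y\<in>carrier GL2. w = yb * x + yc * y))"

lemma wt_zero: "wt i r 0"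
proof -
  have "0 \<in> carrier GL2" using to_frac_in_GL2[of 0] by (simp add: to_frac_simps)
  then show ?thesis unfolding wt_def by (auto intro!: exI[of _ 0] bexI[of _ 0] casimir_simps)
qed

lemma wt_add: assumes "wt i r v" "wt i r w" shows "wt i r (v + w)"
proof -
  obtain y z where "casimir y" "v = y * ya ^ i * yc ^ r" "casimir z" "w = z * ya ^ i * yc ^ r"
    using assms by (auto simp: wt_def)
  then have 1: "\<exists>z. casimir z \<and> v + w = z * ya ^ i * yc ^ r"
    by (intro exI[of _ "y + z"]) (simp add: casimir_simps algebra_simps)
  have 2: "\<exists>x\<in>carrier GL2. \<exists>y\<in>carrier GL2. v + w = yb * x + yc * y" if r: "r > 0"
  proof -
    obtain x1 y1 x2 y2 where "x1 \<in> carrier GL2" "y1 \<in> carrier GL2" "x2 \<in> carrier GL2"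
      "y2 \<in> carrier GL2" "v = yb * x1 + yc * y1" "w = yb * x2 + yc * y2"
      using assms r unfolding wt_def by blast
    then show ?thesis
      by (intro bexI[of _ "x1 + x2"] bexI[of _ "y1 + y2"]) (auto simp: algebra_simps GL2_closed)
  qed
  show ?thesis using assms 1 2 by (auto simp: wt_def GL2_closed)
qed

text \<open>Exponents and Casimir factors multiply separately. The last hypothesis preserves the
  third conjunct of \<open>wt\<close>: a factor with \<open>l > 0\<close> must itself be a multiple
  of \<open>b\<close> or \<open>c\<close> inside \<open>GL2\<close>.\<close>

lemma wt_mult:
  assumes "wt i r w" and "casimir u" and x: "x \<in> carrier GL2" "x = u * ya ^ j * yc ^ l"
    and "l = 0 \<or> (\<exists>y\<in>carrier GL2. x = yb * y) \<or> (\<exists>y\<in>carrier GL2. x = yc * y)"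
  shows "wt (i + j) (r + l) (x * w)"
proof -
  obtain z where z: "casimir z" "w = z * ya ^ i * yc ^ r" using assms by (auto simp: wt_def)
  have w: "w \<in> carrier GL2" using assms(1) by (simp add: wt_def)
  have 0: "0 \<in> carrier GL2" using to_frac_in_GL2[of 0] by (simp add: to_frac_simps)
  have 1: "\<exists>z. casimir z \<and> x * w = z * ya ^ (i + j) * yc ^ (r + l)"
    using z assms(2) by (intro exI[of _ "u * z"]) (simp add: x z(2) casimir_simps power_add)
  have 2: "\<exists>p\<in>carrier GL2. \<exists>q\<in>carrier GL2. x * w = yb * p + yc * q" if rl: "r + l > 0"
  proof -
    consider "r > 0" | y where "y \<in> carrier GL2" "x = yb * y" | y where "y \<in> carrier GL2" "x = yc * y"
      using rl assms(5) by blast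
    then show ?thesis
    proof cases
      case 1
      then obtain p q where "p \<in> carrier GL2" "q \<in> carrier GL2" "w = yb * p + yc * q"
        using assms(1) unfolding wt_def by blast
      then show ?thesis
        by (intro bexI[of _ "x * p"] bexI[of _ "x * q"]) (simp_all add: algebra_simps GL2_closed x(1))
    next
      case 2
      then show ?thesis
        by (intro bexI[of _ "y * w"] bexI[of _ 0]) (simp_all add: GL2_closed w 0)
    next
      case 3
      then show ?thesis
        by (intro bexI[of _ 0] bexI[of _ "y * w"]) (simp_all add: GL2_closed w 0)
    qed
  qed
  show ?thesis unfolding wt_def using 1 2 w x(1) by (simp add: GL2_closed)
qed

text \<open>Weights may repeat among the summands, which makes closure properties easy; equal
  weights are merged afterwards in \<open>wt_span_sum\<close>.\<close>

inductive wt_span :: "'k::field mat_fract \<Rightarrow> bool" where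
  zero: "wt_span 0"
| add: "wt i r w \<Longrightarrow> wt_span v \<Longrightarrow> wt_span (w + v)"

lemma wt_span_wt: "wt i r w \<Longrightarrow> wt_span w"
  using wt_span.add[OF _ wt_span.zero] by fastforce

lemma wt_span_add: "wt_span v \<Longrightarrow> wt_span w \<Longrightarrow> wt_span (v + w)"
  by (induction rule: wt_span.induct) (auto simp: add.assoc intro: wt_span.add)

lemma wt_span_mult:
  assumes "wt_span w" "\<And>i r w. wt i r w \<Longrightarrow> wt_span (x * w)"
  shows "wt_span (x * w)"
  using assms(1) by (induction rule: wt_span.induct)
    (auto simp: distrib_left wt_span.zero intro: wt_span_add assms(2))

text \<open>Each factor has a weight: \<open>a\<close> has (1, 0), \<open>c\<close> has (0, 1),
  \<open>b = (b / c) c\<close> has (0, 1), and \<open>D\<close>, \<open>D^-1\<close> have (0, 0).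
  The generator \<open>d\<close> is absent, since \<open>d = (D + b c) / a\<close> involves a
  negative power of \<open>a\<close>.\<close>

lemma wt_span_mult_gens:
  assumes "wt_span w"
  shows "wt_span (ya * w)" "wt_span (yb * w)" "wt_span (yc * w)"
    "wt_span (yD * w)" "wt_span (inverse yD * w)"
proof -
  have 1: "casimir 1" "1 \<in> carrier GL2"
    using casimir_simps(2)[of 1] scalar_in_GL2[of 1] by (simp_all add: scalar_simps)
  note c = casimir_yD casimir_inverse[OF casimir_yD] casimir_yb_yc(1) 1
  note m = to_frac_in_GL2 inverse_yD_in_GL2
  show "wt_span (ya * w)"
    by (rule wt_span_mult[OF assms], rule wt_span_wt, rule wt_mult[where u=1 and j=1 and l=0])
      (simp_all add: c m)
  show "wt_span (yb * w)"
    by (rule wt_span_mult[OF assms], rule wt_span_wt, rule wt_mult[where u="yb / yc" and j=0 and l=1])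
      (auto simp add: c m gens_nonzero intro: bexI[of _ 1])
  show "wt_span (yc * w)"
    by (rule wt_span_mult[OF assms], rule wt_span_wt, rule wt_mult[where u=1 and j=0 and l=1])
      (auto simp add: c m gens_nonzero intro: bexI[of _ 1])
  show "wt_span (yD * w)"
    by (rule wt_span_mult[OF assms], rule wt_span_wt, rule wt_mult[where u=yD and j=0 and l=0])
      (simp_all add: c m)
  show "wt_span (inverse yD * w)"
    by (rule wt_span_mult[OF assms], rule wt_span_wt, rule wt_mult[where u="inverse yD" and j=0 and l=0])
      (simp_all add: c m)
qed

lemma wt_span_mult_power: "wt_span w \<Longrightarrow> wt_span (ya ^ n * w)"
  by (induction n) (simp_all add: wt_span_mult_gens mult.assoc)

lemma wt_span_ex:
  assumes "x \<in> carrier GL2" shows "\<exists>n. wt_span (ya ^ n * x)"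
  using assms
proof (induction rule: GL2_induct)
  case (1 x)
  have "wt 0 0 (scalar x)" by (auto simp: wt_def scalar_in_GL2 casimir_simps)
  then show ?case by (intro exI[of _ 0]) (simp add: wt_span_wt)
next
  case (2 x y)
  then obtain m n where mn: "wt_span (ya ^ m * x)" "wt_span (ya ^ n * y)" by blast
  show ?case
    using wt_span_add[OF wt_span_mult_power[OF mn(1), of n] wt_span_mult_power[OF mn(2), of m]]
    by (intro exI[of _ "m + n"]) (simp add: power_add algebra_simps)
next
  case (6 x)
  then obtain n where n: "wt_span (ya ^ n * x)" by blast
  \<comment> \<open>Multiplication by \<open>d\<close> costs one more power of \<open>a\<close>,
    which turns it into multiplication by \<open>D + b c\<close>.\<close>
  have "ya * yd = yD + yb * yc" by (simp add: yD_eq)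
  then have "ya ^ Suc n * (yd * x) = yD * (ya ^ n * x) + yb * (yc * (ya ^ n * x))"
    by (metis (no_types, lifting) distrib_right mult.assoc mult.left_commute power_Suc)
  then show ?case
    using n by (intro exI[of _ "Suc n"]) (simp only: wt_span_add wt_span_mult_gens)
qed (metis wt_span_mult_gens mult.left_commute)+

text \<open>Indexing the summands by their weights makes the weights pairwise distinct, as the
  separation argument demands.\<close>

lemma wt_span_sum:
  assumes "wt_span w"
  shows "\<exists>N f. finite N \<and> w = sum f N \<and> (\<forall>i r. wt i r (f (i, r)))"
  using assms
proof (induction rule: wt_span.induct)
  case zero
  show ?case by (rule exI[of _ "{}"], rule exI[of _ "\<lambda>_. 0"]) (simp add: wt_zero)
next
  case (add i r w v)
  then obtain N f where f: "finite N" "v = sum f N" "\<And>i r. wt i r (f (i, r))" by blast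
  \<comment> \<open>\<open>f\<close> may be nonzero outside \<open>N\<close>; cutting it off there
    allows the index \<open>(i, r)\<close> to be added to \<open>N\<close> without changing the
    sum.\<close>
  define g where "g p = (if p \<in> N then f p else 0)" for p
  have g: "wt i r (g (i, r))" for i r using f(3) by (simp add: g_def wt_zero)
  have v: "v = sum g (insert (i, r) N)"
    unfolding f(2) by (rule sum.mono_neutral_cong_left) (use f(1) in \<open>auto simp: g_def\<close>)
  have "sum (g((i, r) := w + g (i, r))) (insert (i, r) N) = w + v"
    unfolding v using f(1) by (subst (1 2) sum.insert_remove) (auto simp: add.assoc intro!: sum.cong)
  then show ?case using f(1) g add(1)
    by (intro exI[of _ "insert (i, r) N"] exI[of _ "g((i, r) := w + g (i, r))"]) (auto intro: wt_add)
qed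

lemma GL2_br_power_eigen:
  assumes "GL2_br u v = e * u * v" shows "GL2_br u (v ^ n) = of_nat n * e * u * v ^ n"
  by (induction n) (simp_all add: GL2_br_one GL2_br_mult_right assms algebra_simps)

text \<open>The Casimir factor drops out. Then \<open>{a, c} = a c\<close> counts the exponent
  \<open>r\<close>, while \<open>{b, a} = - b a\<close> and \<open>{c, a} = - c a\<close> count
  \<open>i\<close>; \<open>b\<close> and \<open>c\<close> commute with \<open>c\<close>.\<close>

lemma wt_eigen:
  fixes w :: "'k::field mat_fract"
  assumes "wt i r w"
  shows "GL2_br ya w = of_nat r * ya * w"
    "GL2_br yb w = - of_nat i * yb * w" "GL2_br yc w = - of_nat i * yc * w"
proof -
  obtain z where z: "casimir z" and w: "w = z * ya ^ i * yc ^ r" using assms by (auto simp: wt_def)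
  have z0: "GL2_br u z = 0" for u using z GL2_br_skew(2)[of u z] by (simp add: casimir_def)
  have "GL2_br (ya :: 'k mat_fract) ya = 0 * ya * ya" "GL2_br (ya :: 'k mat_fract) yc = 1 * ya * yc"
    by (simp_all add: GL2_br_skew(1) GL2_br_gens to_frac_simps)
  from this[THEN GL2_br_power_eigen] show "GL2_br ya w = of_nat r * ya * w"
    unfolding w by (simp add: GL2_br_mult_right z0 algebra_simps)
  have "GL2_br (yb :: 'k mat_fract) ya = -1 * yb * ya" "GL2_br (yb :: 'k mat_fract) yc = 0 * yb * yc"
    by (simp_all add: GL2_br_skew(2)[where y=yb and x=ya] GL2_br_gens to_frac_simps)
  from this[THEN GL2_br_power_eigen] show "GL2_br yb w = - of_nat i * yb * w"
    unfolding w by (simp add: GL2_br_mult_right z0 algebra_simps)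
  have "GL2_br (yc :: 'k mat_fract) ya = -1 * yc * ya" "GL2_br (yc :: 'k mat_fract) yc = 0 * yc * yc"
    by (simp_all add: GL2_br_skew(1) GL2_br_skew(2)[where y=yc and x=ya] GL2_br_gens to_frac_simps)
  from this[THEN GL2_br_power_eigen] show "GL2_br yc w = - of_nat i * yc * w"
    unfolding w by (simp add: GL2_br_mult_right z0 algebra_simps)
qed

section \<open>Poisson primes and separation of weights modulo them\<close>

lemma scalar_add: "scalar (x + y) = scalar x + scalar y" "scalar (x - y) = scalar x - scalar y"
  by (simp_all add: scalar_def flip: to_frac_simps)

lemma scalar_uminus: "scalar (- x) = - scalar x"
  using scalar_add(2)[of 0 x] by (simp add: scalar_def to_frac_simps)

lemma scalar_of_nat: "scalar (of_nat n) = of_nat n"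
  by (induction n) (simp_all add: scalar_add scalar_simps, simp add: scalar_def to_frac_simps)

lemma GL2_simps: "x \<otimes>\<^bsub>GL2\<^esub> y = x * y" "x \<oplus>\<^bsub>GL2\<^esub> y = x + y" "\<one>\<^bsub>GL2\<^esub> = 1" "\<zero>\<^bsub>GL2\<^esub> = 0"
  by (simp_all add: GL2_def)

lemma GL2_01_closed: "0 \<in> carrier GL2" "1 \<in> carrier GL2"
  using to_frac_in_GL2[of 0] to_frac_in_GL2[of 1] by (simp_all add: to_frac_simps)

lemma scalar_0: "scalar 0 = 0"
  by (simp add: scalar_def to_frac_simps)

lemma GL2_br_scalar_right: "GL2_br x (scalar c) = 0"
  using GL2_br_skew(2)[of x "scalar c"] by (simp add: GL2_br_scalar)

lemma GL2_sum_closed: "(\<And>x. f x \<in> carrier GL2) \<Longrightarrow> sum f A \<in> carrier GL2"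
  by (induction A rule: infinite_finite_induct) (simp_all add: GL2_01_closed GL2_closed)

lemma GL2_power_closed: "x \<in> carrier GL2 \<Longrightarrow> x ^ n \<in> carrier GL2"
  by (induction n) (simp_all add: GL2_01_closed GL2_closed)

text \<open>The operations of the ring \<open>GL2\<close> are those of the type, so from here on
  ideals are handled with the field operations directly.\<close>

lemma ideal_GL2D:
  assumes "ideal P GL2"
  shows "P \<subseteq> carrier GL2" "0 \<in> P" "x \<in> P \<Longrightarrow> y \<in> P \<Longrightarrow> x + y \<in> P"
    "x \<in> P \<Longrightarrow> - x \<in> P" "x \<in> P \<Longrightarrow> y \<in> P \<Longrightarrow> x - y \<in> P"
    "x \<in> carrier GL2 \<Longrightarrow> y \<in> P \<Longrightarrow> x * y \<in> P" "x \<in> P \<Longrightarrow> y \<in> carrier GL2 \<Longrightarrow> x * y \<in> P"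
proof -
  interpret P: ideal P GL2 by fact
  show "P \<subseteq> carrier GL2" using P.a_subset .
  show z: "0 \<in> P" using additive_subgroup.zero_closed[OF P.is_additive_subgroup] by (simp add: GL2_simps)
  show add: "x + y \<in> P" if "x \<in> P" "y \<in> P" for x y
    using additive_subgroup.a_closed[OF P.is_additive_subgroup] that by (simp add: GL2_simps)
  show mult: "x * y \<in> P" if "x \<in> carrier GL2" "y \<in> P" for x y
    using P.I_l_closed that by (simp add: GL2_simps)
  show "x * y \<in> P" if "x \<in> P" "y \<in> carrier GL2" using mult[OF that(2,1)] by (simp add: mult.commute)
  show neg: "- x \<in> P" if "x \<in> P" for x
    using mult[of "- 1" x] GL2_closed(3)[OF GL2_01_closed(2) GL2_01_closed(2)] that by simp
  show "x - y \<in> P" if "x \<in> P" "y \<in> P" using add[OF that(1) neg[OF that(2)]] by simp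
qed

lemma ideal_GL2_sum:
  assumes "ideal P GL2" "\<And>x. x \<in> A \<Longrightarrow> f x \<in> P" shows "sum f A \<in> P"
  using assms(2)
  by (induction A rule: infinite_finite_induct) (simp_all add: ideal_GL2D[OF assms(1)])

lemma pspec_GL2D:
  assumes "P \<in> pspec GL2 GL2_br"
  shows "ideal P GL2" "1 \<notin> P"
    "x \<in> carrier GL2 \<Longrightarrow> y \<in> carrier GL2 \<Longrightarrow> x * y \<in> P \<longleftrightarrow> x \<in> P \<or> y \<in> P"
    "x \<in> P \<Longrightarrow> y \<in> carrier GL2 \<Longrightarrow> GL2_br x y \<in> P"
    "x \<in> P \<Longrightarrow> y \<in> carrier GL2 \<Longrightarrow> GL2_br y x \<in> P"
proof -
  have br: "GL2_br x y \<in> P" if "x \<in> P" "y \<in> carrier GL2" for x y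
    using assms that by (simp add: pspec_def)
  interpret P: primeideal P GL2 using assms by (simp add: pspec_def)
  show i: "ideal P GL2" by unfold_locales
  show "GL2_br x y \<in> P" if "x \<in> P" "y \<in> carrier GL2" using br that .
  show "GL2_br y x \<in> P" if "x \<in> P" "y \<in> carrier GL2"
    using ideal_GL2D(4)[OF i br[OF that]] GL2_br_skew(2)[of y x] by simp
  show "1 \<notin> P"
    using ideal_GL2D(6)[OF i, of _ 1] ideal_GL2D(1)[OF i] P.I_notcarr by auto
  show "x * y \<in> P \<longleftrightarrow> x \<in> P \<or> y \<in> P" if "x \<in> carrier GL2" "y \<in> carrier GL2"
    using P.I_prime[OF that] ideal_GL2D(6,7)[OF i] that by (auto simp: GL2_simps)
qed

lemma pspec_scalar_mult:
  assumes "P \<in> pspec GL2 GL2_br" "c \<noteq> 0" "x \<in> carrier GL2" "scalar c * x \<in> P"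
  shows "x \<in> P"
proof -
  have "scalar (inverse c) * (scalar c * x) \<in> P"
    using ideal_GL2D(6)[OF pspec_GL2D(1)[OF assms(1)] scalar_in_GL2 assms(4)] .
  moreover have "scalar (inverse c) * (scalar c * x) = x"
    using assms(2) by (metis mult.assoc scalar_simps left_inverse mult_1)
  ultimately show ?thesis by simp
qed

lemma pspec_power:
  assumes P: "P \<in> pspec GL2 GL2_br" and x: "x \<in> carrier GL2" "x \<notin> P" shows "x ^ n \<notin> P"
  by (induction n) (use x in \<open>simp_all add: pspec_GL2D[OF P] GL2_power_closed\<close>)

text \<open>The usual shortening of a relation between eigenvectors. The operator
  \<open>{u, -} - e u q * u\<close> preserves \<open>Q\<close>, kills the term of index
  \<open>q\<close> and multiplies every other term by a scalar times \<open>u\<close>. As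
  \<open>u\<close> is outside the prime \<open>Q\<close>, it can be cancelled, leaving a shorter
  sum.\<close>

lemma eigen_separation:
  fixes f :: "'i \<Rightarrow> 'k::field mat_fract"
  assumes Q: "Q \<in> pspec GL2 GL2_br" and "finite N"
    and U: "\<And>u. u \<in> U \<Longrightarrow> u \<in> carrier GL2 \<and> u \<notin> Q"
    and sep: "\<And>p q. p \<noteq> q \<Longrightarrow> \<exists>u\<in>U. e u p \<noteq> e u q"
    and f: "\<And>p. f p \<in> carrier GL2"
    and eig: "\<And>u p. u \<in> U \<Longrightarrow> GL2_br u (f p) = scalar (e u p) * u * f p"
    and "sum f N \<in> Q" "p \<in> N"
  shows "f p \<in> Q"
  using assms(2) f eig assms(7,8)
proof (induction "card N" arbitrary: N f p rule: less_induct)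
  case (less N f p)
  note f = less(3) and eig = less(4)
  note i = pspec_GL2D(1)[OF Q]
  show ?case
  proof (cases "N = {p}")
    case True
    then show ?thesis using less by simp
  next
    case False
    then obtain q where q: "q \<in> N" "q \<noteq> p" using less(6) by blast
    obtain u where u: "u \<in> U" "e u p \<noteq> e u q" using sep[of p q] q by metis
    \<comment> \<open>The terms after cancelling \<open>u\<close>: scalar multiples of the old ones,
      hence eigenvectors of the same weights, with the term at \<open>q\<close> gone.\<close>
    define g where "g s = scalar (e u s - e u q) * f s" for s
    have card: "card (N - {q}) < card N" using q less(2) by (meson card_Diff1_less)
    have "GL2_br u (sum f N) - scalar (e u q) * (u * sum f N) \<in> Q"
      by (intro ideal_GL2D(5,6)[OF i] pspec_GL2D(5)[OF Q] scalar_in_GL2 less(5)) (use U u in auto)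
    also have "GL2_br u (sum f N) - scalar (e u q) * (u * sum f N) = u * sum g N"
      by (simp add: GL2_br_sum_right eig[OF u(1)] g_def sum_distrib_left scalar_add
          algebra_simps flip: sum_subtractf)
    finally have "u * sum g N \<in> Q" .
    moreover have g: "g s \<in> carrier GL2" for s unfolding g_def by (intro GL2_closed scalar_in_GL2 f)
    moreover have "sum g N \<in> carrier GL2" using g by (rule GL2_sum_closed)
    ultimately have "sum g N \<in> Q" using U[OF u(1)] pspec_GL2D(3)[OF Q] by blast
    moreover have "sum g N = sum g (N - {q})"
      using less(2) q(1) by (simp add: sum.remove g_def scalar_0)
    ultimately have sum: "sum g (N - {q}) \<in> Q" by simp
    have eig': "GL2_br u (g s) = scalar (e u s) * u * g s" if "u \<in> U" for u s
      unfolding g_def by (simp add: GL2_br_mult_right eig[OF that] GL2_br_scalar_right)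
    have "g p \<in> Q"
      by (rule less(1)[OF card _ g eig' sum]) (use q less in auto)
    then show ?thesis
      \<comment> \<open>The scalar \<open>e u p - e u q\<close> is nonzero by the choice of
        \<open>u\<close>, so it is a unit.\<close>
      unfolding g_def by (rule pspec_scalar_mult[OF Q _ f, rotated]) (use u(2) in simp)
  qed
qed

text \<open>The eigenvalue under \<open>a\<close> recovers \<open>r\<close> and the one under
  \<open>b\<close> or \<open>c\<close> recovers \<open>i\<close>, because \<open>of_nat\<close> is
  injective in characteristic 0. So distinct weights are told apart by an element outside
  \<open>Q\<close>.\<close>

lemma wt_separation:
  fixes Q :: "'k::field_char_0 mat_fract set"
  assumes Q: "Q \<in> pspec GL2 GL2_br" and a: "ya \<notin> Q" and bc: "yb \<notin> Q \<or> yc \<notin> Q"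
    and f: "finite N" "\<And>i r. wt i r (f (i, r))" "sum f N \<in> Q" "p \<in> N"
  shows "f p \<in> Q"
proof -
  define U where "U = {ya, yb, yc} - Q"
  \<comment> \<open>The eigenvalues under \<open>b\<close> and \<open>c\<close> agree, so one case
    distinction suffices; \<open>ne\<close> keeps \<open>ya\<close> apart from both.\<close>
  define e :: "'k mat_fract \<Rightarrow> nat \<times> nat \<Rightarrow> 'k" where
    "e u p = (if u = ya then of_nat (snd p) else - of_nat (fst p))" for u p
  have ne: "ya \<noteq> (yb :: 'k mat_fract)" "ya \<noteq> (yc :: 'k mat_fract)"
    by (simp_all add: to_frac_def eq_fract Y_defs)
  show ?thesis
  proof (rule eigen_separation[where Q=Q and N=N and U=U and e=e and f=f])
    show "\<exists>u\<in>U. e u p \<noteq> e u q" if "p \<noteq> q" for p q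
    proof (cases "snd p = snd q")
      case True
      then have "fst p \<noteq> fst q" using that by (simp add: prod_eq_iff)
      moreover obtain u where "u = yb \<or> u = yc" "u \<notin> Q" using bc by blast
      ultimately show ?thesis using ne by (intro bexI[of _ u]) (auto simp: U_def e_def)
    next
      case False
      then show ?thesis using a by (intro bexI[of _ ya]) (auto simp: U_def e_def)
    qed
    show "f p \<in> carrier GL2" for p using f(2)[of "fst p" "snd p"] by (simp add: wt_def)
    show "GL2_br u (f p) = scalar (e u p) * u * f p" if "u \<in> U" for u p
      using that wt_eigen[OF f(2)[of "fst p" "snd p"]] ne
      by (auto simp: U_def e_def scalar_of_nat scalar_uminus)
  qed (use Q f in \<open>auto simp: U_def to_frac_in_GL2\<close>)
qed

text \<open>\<open>D\<close> is a unit. If \<open>a\<close> were in \<open>P\<close>, then so would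
  be \<open>{a, d} = 2 b c\<close>, hence \<open>b c\<close> as 2 is invertible, hence
  \<open>D = a d - b c\<close>.\<close>

lemma pspec_gens:
  fixes P :: "'k::field_char_0 mat_fract set"
  assumes P: "P \<in> pspec GL2 GL2_br"
  shows "yD \<notin> P" "ya \<notin> P"
proof -
  note D = pspec_GL2D[OF P] and i = ideal_GL2D[OF pspec_GL2D(1)[OF P]]
  show d: "yD \<notin> P"
  proof
    assume "yD \<in> P"
    then have "inverse yD * yD \<in> P" by (rule i(6)[OF inverse_yD_in_GL2])
    moreover have "inverse yD * yD = (1 :: 'k mat_fract)" by (simp add: gens_nonzero)
    ultimately show False using D(2) by simp
  qed
  show "ya \<notin> P"
  proof
    assume a: "ya \<in> P"
    have br: "GL2_br ya yd \<in> P" by (intro D(4) a to_frac_in_GL2)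
    have two: "to_frac 2 = (2 :: 'k mat_fract)" by (metis one_add_one to_frac_simps(1,5))
    have "GL2_br ya yd = scalar (of_nat 2) * (yb * yc :: 'k mat_fract)"
      unfolding GL2_br_gens to_frac_simps scalar_of_nat
      by (simp add: two mult.assoc)
    with br have "scalar (of_nat 2) * (yb * yc) \<in> P" by simp
    then have "yb * yc \<in> P"
      by (rule pspec_scalar_mult[OF P _ GL2_closed(2)[OF to_frac_in_GL2 to_frac_in_GL2], rotated]) simp
    then have "yD \<in> P" unfolding yD_eq by (rule i(5)[OF i(7)[OF a to_frac_in_GL2]])
    then show False using d by simp
  qed
qed

text \<open>Every coefficient in the definition of the bracket is a multiple of \<open>b\<close> or
  of \<open>c\<close>.\<close>

lemma GL2_br_in_bc_ideal:
  assumes P: "ideal P GL2" and "yb \<in> P" "yc \<in> P" "x \<in> carrier GL2" "y \<in> carrier GL2"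
  shows "GL2_br x y \<in> P"
proof -
  have j: "jac D D' x y \<in> carrier GL2" if "derivation D" "derivation D'" for D D'
    unfolding jac_def using that assms by (intro GL2_closed fract_deriv_in_GL2)
  have m: "to_frac (p * Y12) \<in> P" "to_frac (Y12 * p) \<in> P"
    "to_frac (p * Y21) \<in> P" "to_frac (Y21 * p) \<in> P" for p
    unfolding to_frac_simps by (intro ideal_GL2D(6,7)[OF P] assms to_frac_in_GL2)+
  show ?thesis
    unfolding GL2_br_def
    by (intro ideal_GL2D(3)[OF P] ideal_GL2D(7)[OF P _ j] derivation_D m)
qed

text \<open>If \<open>b, c \<in> J\<close>, the bracket vanishes modulo \<open>J\<close>. Otherwise \<open>w\<close> is a weight component of \<open>x\<close> outside \<open>P\<close>,
  which lies in all \<open>Q \<in> Y\<close> by \<open>wt_separation\<close>.\<close>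

lemma exists_central_fraction:
  fixes J :: "'k::field_char_0 mat_fract set"
  assumes J: "ideal J GL2" and P: "P \<in> pspec GL2 GL2_br" and Y: "Y \<subseteq> pspec GL2 GL2_br"
    and bc: "yb \<in> \<Union>Y \<Longrightarrow> yb \<in> J" "yc \<in> \<Union>Y \<Longrightarrow> yc \<in> J"
    and x: "x \<in> carrier GL2" "x \<in> \<Inter>Y" "x \<notin> P"
  obtains w i r v where "w \<in> carrier GL2" "w \<notin> P" "w \<in> \<Inter>Y" "v \<in> {yb, yc}" "v \<notin> P \<or> r = 0"
    "\<forall>y\<in>carrier GL2. ya ^ i * v ^ r * GL2_br w y - w * GL2_br (ya ^ i * v ^ r) y \<in> J"
proof (cases "yb \<in> J \<and> yc \<in> J")
  case True
  \<comment> \<open>Here \<open>x\<close> itself serves as \<open>w\<close>, over the denominator 1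
    given by zero exponents.\<close>
  then show ?thesis
    using x GL2_br_in_bc_ideal[OF J, of x] that[of x yb 0 0] by (simp add: GL2_br_one)
next
  case False
  obtain n where "wt_span (ya ^ n * x)" using wt_span_ex[OF x(1)] by blast
  then obtain N f where f: "finite N" "ya ^ n * x = sum f N" "\<And>i r. wt i r (f (i, r))"
    using wt_span_sum by blast
  have fR: "f p \<in> carrier GL2" for p using f(3)[of "fst p" "snd p"] by (simp add: wt_def)
  have an: "ya ^ n \<in> carrier GL2" by (intro GL2_power_closed to_frac_in_GL2)
  have fQ: "f p \<in> Q" if p: "p \<in> N" and QY: "Q \<in> Y" for p Q
  proof -
    have Q: "Q \<in> pspec GL2 GL2_br" using Y QY by blast
    show ?thesis
    proof (rule wt_separation[OF Q _ _ f(1) f(3) _ p])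
      show "ya \<notin> Q" by (rule pspec_gens(2)[OF Q])
      show "yb \<notin> Q \<or> yc \<notin> Q" using bc QY False by blast
      show "sum f N \<in> Q"
        unfolding f(2)[symmetric]
        by (rule ideal_GL2D(6)[OF pspec_GL2D(1)[OF Q] an]) (use x(2) QY in blast)
    qed
  qed
  have "ya ^ n * x \<notin> P"
    using x pspec_power[OF P to_frac_in_GL2 pspec_gens(2)[OF P]] pspec_GL2D(3)[OF P an x(1)] by blast
  then have "\<not> (\<forall>p\<in>N. f p \<in> P)"
    unfolding f(2) using ideal_GL2_sum[OF pspec_GL2D(1)[OF P], of N f] by metis
  then obtain i r where ir: "(i, r) \<in> N" "f (i, r) \<notin> P" by auto
  define w where "w = f (i, r)"
  have wt: "wt i r w" using f(3) by (simp add: w_def)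
  then obtain z where z: "casimir z" "w = z * ya ^ i * yc ^ r" by (auto simp: wt_def)
  \<comment> \<open>For \<open>r > 0\<close> the third conjunct of \<open>wt\<close> puts
    \<open>w\<close> in the ideal generated by \<open>b\<close> and \<open>c\<close>; since
    \<open>w\<close> is not in \<open>P\<close>, one of the two is not in \<open>P\<close> and can
    be a denominator.\<close>
  have "r = 0 \<or> (\<exists>p\<in>carrier GL2. \<exists>q\<in>carrier GL2. w = yb * p + yc * q)"
    using wt unfolding wt_def by (metis neq0_conv)
  then have "r = 0 \<or> yb \<notin> P \<or> yc \<notin> P"
    using ir(2) ideal_GL2D(3,7)[OF pspec_GL2D(1)[OF P]] unfolding w_def by metis
  then obtain v where v: "v = yb \<or> v = yc" "v \<notin> P \<or> r = 0" by blast
  \<comment> \<open>If \<open>v\<close> is \<open>b\<close>, the power \<open>c^r\<close> is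
    rewritten as \<open>(c / b)^r b^r\<close>, and \<open>(c / b)^r\<close> joins the Casimir
    factor.\<close>
  have "\<exists>t. casimir t \<and> w = t * (ya ^ i * v ^ r)"
  proof (cases "v = yc")
    case True
    then show ?thesis using z by (auto simp: mult.assoc)
  next
    case False
    then have "w = (z * (yc / yb) ^ r) * (ya ^ i * v ^ r)"
      using v(1) z(2) by (simp add: power_divide gens_nonzero)
    then show ?thesis using casimir_simps(4)[OF z(1) casimir_power[OF casimir_yb_yc(2)]] by blast
  qed
  then obtain t where t: "casimir t" "w = t * (ya ^ i * v ^ r)" by blast
  have "ya ^ i * v ^ r * GL2_br w y - w * GL2_br (ya ^ i * v ^ r) y = 0" for y
    using t(1) unfolding t(2) GL2_br_mult_left[of t] by (simp add: casimir_def)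
  then have "\<forall>y\<in>carrier GL2. ya ^ i * v ^ r * GL2_br w y - w * GL2_br (ya ^ i * v ^ r) y \<in> J"
    using ideal_GL2D(2)[OF J] by metis
  moreover have "w \<in> carrier GL2" "w \<notin> P" "w \<in> \<Inter>Y"
    unfolding w_def using ir fQ fR by blast+
  ultimately show ?thesis using v by (intro that) auto
qed

section \<open>Localizations of the quotients\<close>

lemma coset_mem_iff: "y \<in> J +>\<^bsub>GL2\<^esub> x \<longleftrightarrow> y - x \<in> J"
proof
  assume "y - x \<in> J"
  then show "y \<in> J +>\<^bsub>GL2\<^esub> x"
    unfolding a_r_coset_def' by (auto simp: GL2_simps intro!: bexI[of _ "y - x"])
qed (auto simp: a_r_coset_def' GL2_simps)

lemma coset_eq_iff:
  assumes "ideal J GL2" shows "J +>\<^bsub>GL2\<^esub> x = J +>\<^bsub>GL2\<^esub> y \<longleftrightarrow> x - y \<in> J"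
proof
  assume "J +>\<^bsub>GL2\<^esub> x = J +>\<^bsub>GL2\<^esub> y"
  moreover have "x \<in> J +>\<^bsub>GL2\<^esub> x" using ideal_GL2D(2)[OF assms] by (simp add: coset_mem_iff)
  ultimately show "x - y \<in> J" by (simp add: coset_mem_iff)
next
  assume *: "x - y \<in> J"
  have "z - x \<in> J \<longleftrightarrow> z - y \<in> J" for z
    using ideal_GL2D(3)[OF assms, of "z - x" "x - y"] ideal_GL2D(5)[OF assms, of "z - y" "x - y"] *
    by auto
  then show "J +>\<^bsub>GL2\<^esub> x = J +>\<^bsub>GL2\<^esub> y" by (auto simp: coset_mem_iff)
qed

lemma carrier_Quot: "carrier (GL2 Quot J) = (\<lambda>x. J +>\<^bsub>GL2\<^esub> x) ` carrier GL2"
  by (auto simp: FactRing_def A_RCOSETS_def')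

lemma coset_closed: "x \<in> carrier GL2 \<Longrightarrow> J +>\<^bsub>GL2\<^esub> x \<in> carrier (GL2 Quot J)"
  by (simp add: carrier_Quot)

lemma Quot_simps:
  assumes J: "ideal J GL2" and x: "x \<in> carrier GL2" and y: "y \<in> carrier GL2"
  shows "(J +>\<^bsub>GL2\<^esub> x) \<otimes>\<^bsub>GL2 Quot J\<^esub> (J +>\<^bsub>GL2\<^esub> y) = J +>\<^bsub>GL2\<^esub> (x * y)"
    "(J +>\<^bsub>GL2\<^esub> x) \<oplus>\<^bsub>GL2 Quot J\<^esub> (J +>\<^bsub>GL2\<^esub> y) = J +>\<^bsub>GL2\<^esub> (x + y)"
    "(J +>\<^bsub>GL2\<^esub> x) \<ominus>\<^bsub>GL2 Quot J\<^esub> (J +>\<^bsub>GL2\<^esub> y) = J +>\<^bsub>GL2\<^esub> (x - y)"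
proof -
  interpret J: ideal J GL2 by fact
  interpret Q: ring "GL2 Quot J" by (rule J.quotient_is_ring)
  show "(J +>\<^bsub>GL2\<^esub> x) \<otimes>\<^bsub>GL2 Quot J\<^esub> (J +>\<^bsub>GL2\<^esub> y) = J +>\<^bsub>GL2\<^esub> (x * y)"
    using J.rcoset_mult_add[OF x y] by (simp add: FactRing_def GL2_simps)
  have add: "(J +>\<^bsub>GL2\<^esub> x) \<oplus>\<^bsub>GL2 Quot J\<^esub> (J +>\<^bsub>GL2\<^esub> y) = J +>\<^bsub>GL2\<^esub> (x + y)"
    if "x \<in> carrier GL2" "y \<in> carrier GL2" for x y
    using J.a_rcos_sum[OF that] by (simp add: FactRing_def GL2_simps)
  show "(J +>\<^bsub>GL2\<^esub> x) \<oplus>\<^bsub>GL2 Quot J\<^esub> (J +>\<^bsub>GL2\<^esub> y) = J +>\<^bsub>GL2\<^esub> (x + y)" by (rule add[OF x y])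
  have "\<zero>\<^bsub>GL2 Quot J\<^esub> = J +>\<^bsub>GL2\<^esub> 0"
    by (auto simp: FactRing_def coset_mem_iff)
  then have "\<ominus>\<^bsub>GL2 Quot J\<^esub> (J +>\<^bsub>GL2\<^esub> y) = J +>\<^bsub>GL2\<^esub> (- y)"
    using y GL2_closed(3)[OF y y] by (intro Q.minus_equality) (simp_all add: add coset_closed)
  then show "(J +>\<^bsub>GL2\<^esub> x) \<ominus>\<^bsub>GL2 Quot J\<^esub> (J +>\<^bsub>GL2\<^esub> y) = J +>\<^bsub>GL2\<^esub> (x - y)"
    using add[OF x GL2_closed(3)[OF y y]] by (simp add: a_minus_def)
qed

lemma Quot_one: "\<one>\<^bsub>GL2 Quot J\<^esub> = J +>\<^bsub>GL2\<^esub> 1"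
  by (simp add: FactRing_def GL2_simps)

lemma Quot_zero: "\<zero>\<^bsub>GL2 Quot J\<^esub> = J +>\<^bsub>GL2\<^esub> 0"
  by (auto simp: FactRing_def coset_mem_iff)

text \<open>For other representatives,
  \<open>{x', y'} - {x, y} = {x' - x, y} + {x', y' - y}\<close>, which lies in the Poisson ideal
  \<open>J\<close>; so the union is over a single coset.\<close>

lemma quot_br_coset:
  assumes J: "J \<in> pspec GL2 GL2_br" and x: "x \<in> carrier GL2" "y \<in> carrier GL2"
  shows "quot_br GL2 GL2_br J (J +>\<^bsub>GL2\<^esub> x) (J +>\<^bsub>GL2\<^esub> y) = J +>\<^bsub>GL2\<^esub> GL2_br x y"
proof -
  note i = pspec_GL2D(1)[OF J]
  have "J +>\<^bsub>GL2\<^esub> GL2_br x' y' = J +>\<^bsub>GL2\<^esub> GL2_br x y"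
    if "x' \<in> J +>\<^bsub>GL2\<^esub> x" "y' \<in> J +>\<^bsub>GL2\<^esub> y" for x' y'
  proof -
    have d: "x' - x \<in> J" "y' - y \<in> J" using that by (simp_all add: coset_mem_iff)
    have x': "x' \<in> carrier GL2"
      using GL2_closed(1)[OF subsetD[OF ideal_GL2D(1)[OF i] d(1)] x(1)] by simp
    have "GL2_br (x' - x) y + GL2_br x' (y' - y) \<in> J"
      by (intro ideal_GL2D(3)[OF i] pspec_GL2D(4,5)[OF J] d x x')
    then show ?thesis by (simp add: coset_eq_iff[OF i] GL2_br_diff)
  qed
  moreover have "x \<in> J +>\<^bsub>GL2\<^esub> x" "y \<in> J +>\<^bsub>GL2\<^esub> y"
    using ideal_GL2D(2)[OF i] by (simp_all add: coset_mem_iff)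
  ultimately show ?thesis unfolding quot_br_def by blast
qed

section \<open>Fractions over \<open>R / J\<close>, computed with representatives in
  \<open>R\<close>\<close>

lemma (in cring) idealI_cring:
  assumes "I \<subseteq> carrier R" "\<zero> \<in> I" "\<And>x y. x \<in> I \<Longrightarrow> y \<in> I \<Longrightarrow> x \<oplus> y \<in> I"
    "\<And>x y. x \<in> carrier R \<Longrightarrow> y \<in> I \<Longrightarrow> x \<otimes> y \<in> I"
  shows "ideal I R"
proof (rule idealI)
  show "subgroup I (add_monoid R)"
  proof (rule add.subgroupI)
    fix x assume "x \<in> I"
    then show "\<ominus> x \<in> I"
      using assms(4)[of "\<ominus> \<one>" x] assms(1) l_minus[of \<one> x] by auto
  qed (use assms in auto)
  show "y \<otimes> x \<in> I" if "y \<in> I" "x \<in> carrier R" for x y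
    using assms(4)[OF that(2,1)] assms(1) that m_comm by (metis subsetD)
qed (use assms ring_axioms in auto)

text \<open>One setting for all three localizations: \<open>E J\<close> and \<open>E2 J K\<close>
  over \<open>J\<close>, and \<open>E K\<close> over \<open>K\<close>. Since \<open>J\<close> is
  prime and zero is no denominator, every denominator can be cancelled.\<close>

locale quotient_localization =
  fixes J :: "'k::field mat_fract set" and S :: "'k mat_fract set set"
  assumes J: "J \<in> pspec GL2 GL2_br"
    and S_carrier: "S \<subseteq> carrier (GL2 Quot J)"
    and S_one: "\<one>\<^bsub>GL2 Quot J\<^esub> \<in> S"
    and S_mult: "\<And>X Y. X \<in> S \<Longrightarrow> Y \<in> S \<Longrightarrow> X \<otimes>\<^bsub>GL2 Quot J\<^esub> Y \<in> S"
    and S_zero: "\<zero>\<^bsub>GL2 Quot J\<^esub> \<notin> S"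
begin

lemmas J_ideal = pspec_GL2D(1)[OF J]
lemmas J_closed = ideal_GL2D[OF J_ideal]

text \<open>Denominators are lifted to \<open>R\<close>, so that statements about fractions become
  congruences modulo \<open>J\<close> between elements of the fraction field.\<close>

definition den where "den = {s \<in> carrier GL2. J +>\<^bsub>GL2\<^esub> s \<in> S}"
definition fr where "fr x s = fraction (GL2 Quot J) S (J +>\<^bsub>GL2\<^esub> x) (J +>\<^bsub>GL2\<^esub> s)"

lemma den_carrier: "s \<in> den \<Longrightarrow> s \<in> carrier GL2" by (simp add: den_def)

lemma den_one: "1 \<in> den" using S_one by (simp add: den_def Quot_one GL2_01_closed)

lemma den_mult: "s \<in> den \<Longrightarrow> t \<in> den \<Longrightarrow> s * t \<in> den"
  using S_mult[of "J +>\<^bsub>GL2\<^esub> s" "J +>\<^bsub>GL2\<^esub> t"] by (simp add: den_def Quot_simps[OF J_ideal] GL2_closed)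

lemma den_not_in_J: "s \<in> den \<Longrightarrow> s \<notin> J"
  using S_zero coset_eq_iff[OF J_ideal, of s 0] by (auto simp: den_def Quot_zero)

lemmas closed = GL2_closed GL2_01_closed GL2_br_closed den_carrier den_one den_mult

lemma cancel: "s \<in> den \<Longrightarrow> x \<in> carrier GL2 \<Longrightarrow> s * x \<in> J \<longleftrightarrow> x \<in> J"
  by (simp add: pspec_GL2D(3)[OF J] den_not_in_J den_carrier)

lemma S_iff: "U \<in> S \<longleftrightarrow> (\<exists>u\<in>den. U = J +>\<^bsub>GL2\<^esub> u)"
  using S_carrier unfolding den_def carrier_Quot by auto

text \<open>The auxiliary factor \<open>u\<close> in \<open>fraction\<close> is outside the prime
  \<open>J\<close> and cancels.\<close>

lemma mem_fr_iff:
  assumes "x \<in> carrier GL2" "s \<in> den" "y \<in> carrier GL2" "t \<in> den"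
  shows "(J +>\<^bsub>GL2\<^esub> y, J +>\<^bsub>GL2\<^esub> t) \<in> fr x s \<longleftrightarrow> t * x - s * y \<in> J"
proof -
  have "(J +>\<^bsub>GL2\<^esub> y, J +>\<^bsub>GL2\<^esub> t) \<in> fr x s \<longleftrightarrow>
    (\<exists>u\<in>den. J +>\<^bsub>GL2\<^esub> (u * (t * x)) = J +>\<^bsub>GL2\<^esub> (u * (s * y)))"
    using assms unfolding fr_def fraction_def Bex_def
    by (auto simp: S_iff Quot_simps[OF J_ideal] closed coset_closed)
  also have "\<dots> \<longleftrightarrow> (\<exists>u\<in>den. u * (t * x - s * y) \<in> J)"
    by (simp add: coset_eq_iff[OF J_ideal] algebra_simps)
  also have "\<dots> \<longleftrightarrow> t * x - s * y \<in> J"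
    using assms den_one by (auto simp: cancel closed)
  finally show ?thesis .
qed

lemma fr_elemE:
  assumes "p \<in> fr x s" "x \<in> carrier GL2" "s \<in> den"
  obtains y t where "p = (J +>\<^bsub>GL2\<^esub> y, J +>\<^bsub>GL2\<^esub> t)" "y \<in> carrier GL2" "t \<in> den" "t * x - s * y \<in> J"
proof -
  obtain y t where yt: "p = (J +>\<^bsub>GL2\<^esub> y, J +>\<^bsub>GL2\<^esub> t)" "y \<in> carrier GL2" "t \<in> den"
    using assms(1) unfolding fr_def fraction_def carrier_Quot by (auto simp: S_iff)
  then show ?thesis using that assms mem_fr_iff by blast
qed

lemma fr_eq_iff:
  assumes "x \<in> carrier GL2" "s \<in> den" "y \<in> carrier GL2" "t \<in> den"
  shows "fr x s = fr y t \<longleftrightarrow> t * x - s * y \<in> J"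
proof
  assume "fr x s = fr y t"
  moreover have "(J +>\<^bsub>GL2\<^esub> y, J +>\<^bsub>GL2\<^esub> t) \<in> fr y t"
    using assms J_closed(2) by (simp add: mem_fr_iff)
  ultimately have "(J +>\<^bsub>GL2\<^esub> y, J +>\<^bsub>GL2\<^esub> t) \<in> fr x s" by simp
  then show "t * x - s * y \<in> J" by (simp add: mem_fr_iff[OF assms])
next
  assume *: "t * x - s * y \<in> J"
  have sub: "fr x s \<subseteq> fr y t"
    if c: "x \<in> carrier GL2" "s \<in> den" "y \<in> carrier GL2" "t \<in> den" and *: "t * x - s * y \<in> J"
    for x y s t
  proof
    fix p assume "p \<in> fr x s"
    then obtain z r where z: "p = (J +>\<^bsub>GL2\<^esub> z, J +>\<^bsub>GL2\<^esub> r)" "z \<in> carrier GL2" "r \<in> den" "r * x - s * z \<in> J"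
      using c fr_elemE by metis
    \<comment> \<open>Transitivity: this combination equals \<open>s * (r * y - t * z)\<close>, and
      \<open>s\<close> cancels.\<close>
    have "t * (r * x - s * z) - r * (t * x - s * y) \<in> J"
      by (intro J_closed(5,6) closed z c *)
    then have "s * (r * y - t * z) \<in> J" by (simp add: algebra_simps)
    then have "r * y - t * z \<in> J" using c z by (simp add: cancel closed)
    then show "p \<in> fr y t" using c z by (simp add: mem_fr_iff)
  qed
  have "s * y - t * x \<in> J" using J_closed(4)[OF *] by simp
  then show "fr x s = fr y t" using sub[OF assms *] sub[OF assms(3,4,1,2)] by blast
qed

text \<open>Evaluates operations defined by unions over representatives: the class is nonempty and
  every member contributes the same value.\<close>

lemma UN_fr:
  assumes "x \<in> carrier GL2" "s \<in> den"
    and "\<And>y t. y \<in> carrier GL2 \<Longrightarrow> t \<in> den \<Longrightarrow> s * y - t * x \<in> J \<Longrightarrow> H (J +>\<^bsub>GL2\<^esub> y) (J +>\<^bsub>GL2\<^esub> t) = V"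
  shows "(\<Union>(a, s)\<in>fr x s. H a s) = V"
proof -
  have "H (fst p) (snd p) = V" if p: "p \<in> fr x s" for p
  proof -
    obtain y t where yt: "p = (J +>\<^bsub>GL2\<^esub> y, J +>\<^bsub>GL2\<^esub> t)" "y \<in> carrier GL2" "t \<in> den" "t * x - s * y \<in> J"
      using p assms fr_elemE by metis
    then show ?thesis using assms(3)[of y t] J_closed(4)[OF yt(4)] by simp
  qed
  moreover have "(J +>\<^bsub>GL2\<^esub> x, J +>\<^bsub>GL2\<^esub> s) \<in> fr x s"
    using assms J_closed(2) by (simp add: mem_fr_iff)
  ultimately show ?thesis unfolding case_prod_beta by blast
qed

section \<open>Ring structure of the localization\<close>

abbreviation "L \<equiv> loc_ring (GL2 Quot J) S"

lemma carrier_L: "carrier L = {fr x s | x s. x \<in> carrier GL2 \<and> s \<in> den}"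
  unfolding loc_ring_def fr_def by (auto simp: carrier_Quot S_iff)

lemma carrier_LE:
  assumes "z \<in> carrier L" obtains x s where "z = fr x s" "x \<in> carrier GL2" "s \<in> den"
  using assms by (auto simp: carrier_L)

lemma fr_closed: "x \<in> carrier GL2 \<Longrightarrow> s \<in> den \<Longrightarrow> fr x s \<in> carrier L"
  by (auto simp: carrier_L)

lemma L_simps:
  assumes x: "x \<in> carrier GL2" "s \<in> den" and y: "y \<in> carrier GL2" "t \<in> den"
  shows "fr x s \<otimes>\<^bsub>L\<^esub> fr y t = fr (x * y) (s * t)"
    "fr x s \<oplus>\<^bsub>L\<^esub> fr y t = fr (t * x + s * y) (s * t)"
proof -
  note fold = fr_def[symmetric]
  have "fr (x' * y') (s' * t') = fr (x * y) (s * t)"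
    if c: "x' \<in> carrier GL2" "s' \<in> den" "y' \<in> carrier GL2" "t' \<in> den"
      and e: "s * x' - s' * x \<in> J" "t * y' - t' * y \<in> J" for x' y' s' t'
  proof -
    \<comment> \<open>Well-definedness: this is the cross difference
      \<open>s * t * x' * y' - s' * t' * x * y\<close> of the two products; the sum is treated
      likewise below.\<close>
    have "t * y' * (s * x' - s' * x) + s' * x * (t * y' - t' * y) \<in> J"
      by (intro J_closed(3,6) closed c e x y)
    then show ?thesis
      using c x y by (subst fr_eq_iff) (simp_all add: closed, simp add: algebra_simps)
  qed
  then show "fr x s \<otimes>\<^bsub>L\<^esub> fr y t = fr (x * y) (s * t)"
    unfolding loc_ring_def
    by (simp, intro UN_fr x y) (simp add: Quot_simps[OF J_ideal] closed fold)
  have "fr (t' * x' + s' * y') (s' * t') = fr (t * x + s * y) (s * t)"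
    if c: "x' \<in> carrier GL2" "s' \<in> den" "y' \<in> carrier GL2" "t' \<in> den"
      and e: "s * x' - s' * x \<in> J" "t * y' - t' * y \<in> J" for x' y' s' t'
  proof -
    have "t * t' * (s * x' - s' * x) + s * s' * (t * y' - t' * y) \<in> J"
      by (intro J_closed(3,6) closed c e x y)
    then show ?thesis
      using c x y by (subst fr_eq_iff) (simp_all add: closed, simp add: algebra_simps)
  qed
  then show "fr x s \<oplus>\<^bsub>L\<^esub> fr y t = fr (t * x + s * y) (s * t)"
    unfolding loc_ring_def
    by (simp, intro UN_fr x y) (simp add: Quot_simps[OF J_ideal] closed fold)
qed

lemma L_one: "\<one>\<^bsub>L\<^esub> = fr 1 1" and L_zero: "\<zero>\<^bsub>L\<^esub> = fr 0 1"
  by (simp_all add: loc_ring_def fr_def Quot_one Quot_zero)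

lemma L_cring: "cring L"
proof (intro cringI abelian_groupI comm_monoidI)
  fix x assume "x \<in> carrier L"
  then obtain a s where a: "x = fr a s" "a \<in> carrier GL2" "s \<in> den" by (rule carrier_LE)
  then show "\<exists>y\<in>carrier L. y \<oplus>\<^bsub>L\<^esub> x = \<zero>\<^bsub>L\<^esub>"
    by (intro bexI[of _ "fr (- a) s"])
      (simp_all add: L_simps L_zero closed closed(3)[OF a(2,2)] fr_eq_iff J_closed(2) fr_closed)
qed (((elim carrier_LE)?,
    simp add: L_simps L_zero L_one closed fr_closed fr_eq_iff J_closed(2) algebra_simps)+)

text \<open>Centrality of \<open>x / s\<close>, by the quotient rule: it suffices to test against numerators.\<close>

definition cen where
  "cen x s \<longleftrightarrow> (\<forall>y\<in>carrier GL2. s * GL2_br x y - x * GL2_br s y \<in> J)"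

text \<open>Centrality belongs to the fraction and not to its representative. Taking brackets of
  \<open>s * x' - s' * x\<close> with \<open>y\<close> and removing the terms controlled by
  \<open>cen x s\<close> leaves \<open>s * s\<close> times the required numerator, and
  \<open>s\<close> cancels.\<close>

lemma cen_cong:
  assumes c: "x \<in> carrier GL2" "s \<in> den" "x' \<in> carrier GL2" "s' \<in> den"
    and e: "s * x' - s' * x \<in> J" and "cen x s"
  shows "cen x' s'"
  unfolding cen_def
proof
  fix y :: "'k mat_fract" assume y: "y \<in> carrier GL2"
  have *: "s * GL2_br x y - x * GL2_br s y \<in> J" using assms y by (simp add: cen_def)
  have "s * s' * GL2_br (s * x' - s' * x) y + s' * s' * (s * GL2_br x y - x * GL2_br s y)
      - (s * GL2_br s' y + s' * GL2_br s y) * (s * x' - s' * x) \<in> J"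
    by (intro J_closed(3,5,6) pspec_GL2D(4)[OF J] closed c e * y)
  then have "s * (s * (s' * GL2_br x' y - x' * GL2_br s' y)) \<in> J"
    by (simp add: GL2_br_diff GL2_br_mult_left algebra_simps)
  then show "s' * GL2_br x' y - x' * GL2_br s' y \<in> J"
    using c y by (simp add: cancel closed)
qed

section \<open>The Poisson centre of the localization\<close>

abbreviation "lbr \<equiv> loc_br (GL2 Quot J) (quot_br GL2 GL2_br J) S"
abbreviation "Z \<equiv> pcentre L lbr"

text \<open>Regroups the numerator of \<open>{a / s, b / t}\<close> as
  \<open>t N(b) - b N(t)\<close> with \<open>N(y) = s {a, y} - a {s, y}\<close>, the expression
  tested in \<open>cen\<close>.\<close>

lemma loc_br_coset:
  assumes "a \<in> carrier GL2" "s \<in> den" "b \<in> carrier GL2" "t \<in> den"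
  shows "fraction (GL2 Quot J) S
       (((((J +>\<^bsub>GL2\<^esub> s) \<otimes>\<^bsub>GL2 Quot J\<^esub> (J +>\<^bsub>GL2\<^esub> t)) \<otimes>\<^bsub>GL2 Quot J\<^esub> quot_br GL2 GL2_br J (J +>\<^bsub>GL2\<^esub> a) (J +>\<^bsub>GL2\<^esub> b))
        \<ominus>\<^bsub>GL2 Quot J\<^esub> (((J +>\<^bsub>GL2\<^esub> a) \<otimes>\<^bsub>GL2 Quot J\<^esub> (J +>\<^bsub>GL2\<^esub> t)) \<otimes>\<^bsub>GL2 Quot J\<^esub> quot_br GL2 GL2_br J (J +>\<^bsub>GL2\<^esub> s) (J +>\<^bsub>GL2\<^esub> b))
        \<ominus>\<^bsub>GL2 Quot J\<^esub> (((J +>\<^bsub>GL2\<^esub> s) \<otimes>\<^bsub>GL2 Quot J\<^esub> (J +>\<^bsub>GL2\<^esub> b)) \<otimes>\<^bsub>GL2 Quot J\<^esub> quot_br GL2 GL2_br J (J +>\<^bsub>GL2\<^esub> a) (J +>\<^bsub>GL2\<^esub> t)))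
        \<oplus>\<^bsub>GL2 Quot J\<^esub> (((J +>\<^bsub>GL2\<^esub> a) \<otimes>\<^bsub>GL2 Quot J\<^esub> (J +>\<^bsub>GL2\<^esub> b)) \<otimes>\<^bsub>GL2 Quot J\<^esub> quot_br GL2 GL2_br J (J +>\<^bsub>GL2\<^esub> s) (J +>\<^bsub>GL2\<^esub> t)))
       (((J +>\<^bsub>GL2\<^esub> s) \<otimes>\<^bsub>GL2 Quot J\<^esub> (J +>\<^bsub>GL2\<^esub> s)) \<otimes>\<^bsub>GL2 Quot J\<^esub> ((J +>\<^bsub>GL2\<^esub> t) \<otimes>\<^bsub>GL2 Quot J\<^esub> (J +>\<^bsub>GL2\<^esub> t)))
    = fr (t * (s * GL2_br a b - a * GL2_br s b) - b * (s * GL2_br a t - a * GL2_br s t)) (s * s * (t * t))"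
  using assms unfolding fr_def
  by (simp add: quot_br_coset[OF J] Quot_simps[OF J_ideal] closed) (simp add: algebra_simps)

lemma Z_iff:
  assumes x: "x \<in> carrier GL2" "s \<in> den"
  shows "fr x s \<in> carrier Z \<longleftrightarrow> cen x s"
proof
  assume z: "fr x s \<in> carrier Z"
  show "cen x s" unfolding cen_def
  proof
    fix y :: "'k mat_fract" assume y: "y \<in> carrier GL2"
    have m: "(J +>\<^bsub>GL2\<^esub> x, J +>\<^bsub>GL2\<^esub> s) \<in> fr x s" "(J +>\<^bsub>GL2\<^esub> y, J +>\<^bsub>GL2\<^esub> 1) \<in> fr y 1"
      using x y J_closed(2) by (simp_all add: mem_fr_iff closed)
    define w where "w = s * GL2_br x y - x * GL2_br s y"
    have w: "w \<in> carrier GL2" using x y by (simp add: w_def closed)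
    \<comment> \<open>A single pair of representatives is enough here: its contribution to the union
      is the class of \<open>w / s^2\<close>, which must therefore lie in the zero class.\<close>
    have "fr w (s * s) \<subseteq> lbr (fr x s) (fr y 1)"
      unfolding loc_br_def
      by (rule order_trans[OF _ UN_upper[OF m(1)]], unfold prod.case,
          rule order_trans[OF _ UN_upper[OF m(2)]], unfold prod.case,
          subst loc_br_coset) (use x y in \<open>simp_all add: closed GL2_br_one w_def\<close>)
    also have "\<dots> = fr 0 1" using z fr_closed[OF y den_one] by (simp add: pcentre_def L_zero)
    finally have "(J +>\<^bsub>GL2\<^esub> w, J +>\<^bsub>GL2\<^esub> (s * s)) \<in> fr 0 1"
      using mem_fr_iff[OF w den_mult[OF x(2,2)] w den_mult[OF x(2,2)]] J_closed(2) by auto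
    then have "0 - w \<in> J" using mem_fr_iff[OF _ _ w den_mult[OF x(2,2)], of 0 1] by (simp add: closed)
    then show "s * GL2_br x y - x * GL2_br s y \<in> J" using J_closed(4)[of "0 - w"] by (simp add: w_def)
  qed
next
  assume *: "cen x s"
  have "lbr (fr x s) (fr y t) = fr 0 1" if y: "y \<in> carrier GL2" "t \<in> den" for y t
    unfolding loc_br_def
  proof (intro UN_fr x y, subst loc_br_coset)
    fix x' s' y' t' :: "'k mat_fract"
    assume c: "x' \<in> carrier GL2" "s' \<in> den" "y' \<in> carrier GL2" "t' \<in> den" and e: "s * x' - s' * x \<in> J"
    \<comment> \<open>Here all representatives in the union count, and \<open>cen_cong\<close>
      carries centrality to each of them.\<close>
    have c': "cen x' s'" by (rule cen_cong[OF x c(1,2) e *])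
    have "t' * (s' * GL2_br x' y' - x' * GL2_br s' y') - y' * (s' * GL2_br x' t' - x' * GL2_br s' t') \<in> J"
      by (intro J_closed(5,6) c closed c'[unfolded cen_def, rule_format])
    then show "fr (t' * (s' * GL2_br x' y' - x' * GL2_br s' y') - y' * (s' * GL2_br x' t' - x' * GL2_br s' t'))
       (s' * s' * (t' * t')) = fr 0 1"
      using c by (subst fr_eq_iff) (simp_all add: closed)
  qed
  then have "\<forall>w\<in>carrier L. lbr (fr x s) w = \<zero>\<^bsub>L\<^esub>"
    unfolding L_zero by (metis carrier_LE)
  then show "fr x s \<in> carrier Z"
    using fr_closed[OF x] by (simp add: pcentre_def)
qed

lemma carrier_Z: "carrier Z = {fr x s | x s. x \<in> carrier GL2 \<and> s \<in> den \<and> cen x s}"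
proof -
  have "\<exists>x s. z = fr x s \<and> x \<in> carrier GL2 \<and> s \<in> den \<and> cen x s" if "z \<in> carrier Z" for z
  proof -
    have "z \<in> carrier L" using that by (simp add: pcentre_def)
    then show ?thesis using that by (metis carrier_LE Z_iff)
  qed
  then show ?thesis by (auto simp: Z_iff)
qed

lemma Z_simps: "\<one>\<^bsub>Z\<^esub> = \<one>\<^bsub>L\<^esub>" "\<zero>\<^bsub>Z\<^esub> = \<zero>\<^bsub>L\<^esub>" "x \<otimes>\<^bsub>Z\<^esub> y = x \<otimes>\<^bsub>L\<^esub> y" "x \<oplus>\<^bsub>Z\<^esub> y = x \<oplus>\<^bsub>L\<^esub> y"
  by (simp_all add: pcentre_def)

lemma cen_closed:
  assumes x: "x \<in> carrier GL2" "s \<in> den" "cen x s" and y: "y \<in> carrier GL2" "t \<in> den" "cen y t"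
  shows "cen (x * y) (s * t)" "cen (t * x + s * y) (s * t)" "cen (- x) s"
proof -
  have xy: "s * GL2_br x u - x * GL2_br s u \<in> J" "t * GL2_br y u - y * GL2_br t u \<in> J"
    if "u \<in> carrier GL2" for u using x(3) y(3) that by (auto simp: cen_def)
  show "cen (x * y) (s * t)" unfolding cen_def
  proof
    fix u :: "'k mat_fract" assume u: "u \<in> carrier GL2"
    have "t * y * (s * GL2_br x u - x * GL2_br s u) + s * x * (t * GL2_br y u - y * GL2_br t u) \<in> J"
      by (intro J_closed(3,6) xy u x y closed)
    then show "s * t * GL2_br (x * y) u - x * y * GL2_br (s * t) u \<in> J"
      by (simp add: GL2_br_mult_left algebra_simps)
  qed
  show "cen (t * x + s * y) (s * t)" unfolding cen_def
  proof
    fix u :: "'k mat_fract" assume u: "u \<in> carrier GL2"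
    have "t * t * (s * GL2_br x u - x * GL2_br s u) + s * s * (t * GL2_br y u - y * GL2_br t u) \<in> J"
      by (intro J_closed(3,6) xy u x y closed)
    then show "s * t * GL2_br (t * x + s * y) u - (t * x + s * y) * GL2_br (s * t) u \<in> J"
      by (simp add: GL2_br_mult_left GL2_br_add_left algebra_simps)
  qed
  show "cen (- x) s" unfolding cen_def
  proof
    fix u :: "'k mat_fract" assume u: "u \<in> carrier GL2"
    show "s * GL2_br (- x) u - - x * GL2_br s u \<in> J"
      using J_closed(4)[OF xy(1)[OF u]] by (simp add: GL2_br_minus)
  qed
qed

lemma cen_one: "cen 1 1"
  by (simp add: cen_def J_closed(2))

lemma L_minus:
  assumes "x \<in> carrier GL2" "s \<in> den" shows "\<ominus>\<^bsub>L\<^esub> fr x s = fr (- x) s"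
proof -
  interpret L: cring L by (rule L_cring)
  show ?thesis using assms closed(3)[OF assms(1,1)]
    by (intro L.minus_equality) (simp_all add: L_simps L_zero closed fr_eq_iff J_closed(2) fr_closed)
qed

lemma Z_cring: "cring Z"
proof -
  interpret L: cring L by (rule L_cring)
  have "subring (carrier Z) L"
  proof (rule L.subringI)
    show "carrier Z \<subseteq> carrier L" by (auto simp: pcentre_def)
    show "\<one>\<^bsub>L\<^esub> \<in> carrier Z" unfolding L_one by (simp add: Z_iff closed cen_one)
    show "\<ominus>\<^bsub>L\<^esub> h \<in> carrier Z" if h: "h \<in> carrier Z" for h
    proof -
      obtain x s where x: "x \<in> carrier GL2" "s \<in> den" "cen x s" and h: "h = fr x s"
        using h by (auto simp: carrier_Z)
      show ?thesis
        using x cen_closed(3)[OF x x] closed(3)[OF x(1,1)] by (simp add: h L_minus Z_iff)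
    qed
    fix h h' assume h: "h \<in> carrier Z" "h' \<in> carrier Z"
    obtain x s where x: "x \<in> carrier GL2" "s \<in> den" "cen x s" and h1: "h = fr x s"
      using h by (auto simp: carrier_Z)
    obtain y t where y: "y \<in> carrier GL2" "t \<in> den" "cen y t" and h2: "h' = fr y t"
      using h by (auto simp: carrier_Z)
    show "h \<otimes>\<^bsub>L\<^esub> h' \<in> carrier Z" "h \<oplus>\<^bsub>L\<^esub> h' \<in> carrier Z"
      using x y cen_closed(1,2)[OF x y] by (simp_all add: h1 h2 L_simps Z_iff closed)
  qed
  then have "cring (L\<lparr>carrier := carrier Z\<rparr>)"
    using L.subcring_iff[of "carrier Z"] L.subcringI' subringE(1) by blast
  then show ?thesis by (simp add: pcentre_def)
qed

section \<open>Extended ideals and their intersection with the Poisson centre\<close>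

definition ext where "ext P = {fr x s | x s. x \<in> P \<and> s \<in> den}"

context
  fixes P
  assumes P: "P \<in> pspec GL2 GL2_br" and JP: "J \<subseteq> P" and dP: "den \<inter> P = {}"
begin

lemmas P_closed = ideal_GL2D[OF pspec_GL2D(1)[OF P]]

text \<open>If \<open>x / s = y / t\<close> with \<open>y\<close> in \<open>P\<close>, then
  \<open>t x\<close> is in \<open>P\<close> because \<open>J\<close> is contained in
  \<open>P\<close>, and \<open>t\<close> is not. All later comparisons of spectra reduce to
  membership of numerators through this.\<close>

lemma fr_ext_iff:
  assumes x: "x \<in> carrier GL2" "s \<in> den" shows "fr x s \<in> ext P \<longleftrightarrow> x \<in> P"
proof
  assume "fr x s \<in> ext P"
  then obtain y t where y: "fr x s = fr y t" "y \<in> P" "t \<in> den" by (auto simp: ext_def)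
  then have "y \<in> carrier GL2" using P_closed(1) by blast
  then have "t * x - s * y \<in> P" using y(1) fr_eq_iff[OF x _ y(3)] JP by blast
  then have "t * x - s * y + s * y \<in> P" by (intro P_closed(3,6) closed x y)
  then show "x \<in> P" using pspec_GL2D(3)[OF P den_carrier[OF y(3)] x(1)] dP y(3) by auto
qed (use x in \<open>auto simp: ext_def\<close>)

lemma ext_ideal: "ideal (ext P) L"
proof -
  interpret L: cring L by (rule L_cring)
  have c: "ext P \<subseteq> carrier L" unfolding ext_def carrier_L using P_closed(1) by blast
  show ?thesis
  proof (rule L.idealI_cring)
    show "\<zero>\<^bsub>L\<^esub> \<in> ext P" unfolding L_zero by (simp add: fr_ext_iff closed P_closed(2))
    show "x \<oplus>\<^bsub>L\<^esub> y \<in> ext P" if xy: "x \<in> ext P" "y \<in> ext P" for x y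
    proof -
      obtain a s b t where "x = fr a s" "a \<in> P" "s \<in> den" "y = fr b t" "b \<in> P" "t \<in> den"
        using xy by (auto simp: ext_def)
      moreover from this have "a \<in> carrier GL2" "b \<in> carrier GL2" using P_closed(1) by auto
      ultimately show ?thesis by (simp add: L_simps fr_ext_iff closed P_closed)
    qed
    show "x \<otimes>\<^bsub>L\<^esub> y \<in> ext P" if xy: "x \<in> carrier L" "y \<in> ext P" for x y
    proof -
      obtain a s b t where "x = fr a s" "a \<in> carrier GL2" "s \<in> den" "y = fr b t" "b \<in> P" "t \<in> den"
        using xy by (auto simp: ext_def carrier_L)
      moreover from this have "b \<in> carrier GL2" using P_closed(1) by auto
      ultimately show ?thesis by (simp add: L_simps fr_ext_iff closed P_closed)
    qed
  qed (rule c)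
qed

text \<open>One inclusion is minimality of the generated ideal; the other comes from
  \<open>x / s = (1 / s) (x / 1)\<close>.\<close>

lemma loc_ext_eq: "loc_ext (GL2 Quot J) S (ideal_quot GL2 J P) = ext P"
proof -
  interpret L: cring L by (rule L_cring)
  have g: "(\<lambda>x. fraction (GL2 Quot J) S x \<one>\<^bsub>GL2 Quot J\<^esub>) ` ideal_quot GL2 J P = (\<lambda>x. fr x 1) ` P"
    by (simp add: ideal_quot_def image_image fr_def Quot_one)
  have sub: "(\<lambda>x. fr x 1) ` P \<subseteq> carrier L"
    using P_closed(1) by (auto intro: fr_closed closed)
  show ?thesis unfolding loc_ext_def g
  proof (rule subset_antisym)
    show "Idl\<^bsub>L\<^esub> ((\<lambda>x. fr x 1) ` P) \<subseteq> ext P"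
      by (rule L.genideal_minimal[OF ext_ideal]) (unfold ext_def, use den_one in blast)
    show "ext P \<subseteq> Idl\<^bsub>L\<^esub> ((\<lambda>x. fr x 1) ` P)"
    proof
      fix z assume "z \<in> ext P"
      then obtain x s where z: "z = fr x s" "x \<in> P" "s \<in> den" by (auto simp: ext_def)
      then have x: "x \<in> carrier GL2" using P_closed(1) by auto
      have "fr 1 s \<otimes>\<^bsub>L\<^esub> fr x 1 \<in> Idl\<^bsub>L\<^esub> ((\<lambda>x. fr x 1) ` P)"
        using ideal.I_l_closed[OF L.genideal_ideal[OF sub]] L.genideal_self[OF sub] z
        by (meson closed fr_closed image_eqI subsetD)
      then show "z \<in> Idl\<^bsub>L\<^esub> ((\<lambda>x. fr x 1) ` P)" using x z by (simp add: L_simps closed)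
    qed
  qed
qed

lemma ext_Z_prime: "ext P \<inter> carrier Z \<in> spec Z"
proof -
  interpret Z: cring Z by (rule Z_cring)
  interpret I: ideal "ext P" L by (rule ext_ideal)
  have c: "carrier Z \<subseteq> carrier L" by (auto simp: pcentre_def)
  have "ideal (ext P \<inter> carrier Z) Z"
  proof (rule Z.idealI_cring)
    show "x \<oplus>\<^bsub>Z\<^esub> y \<in> ext P \<inter> carrier Z" if "x \<in> ext P \<inter> carrier Z" "y \<in> ext P \<inter> carrier Z" for x y
      using that Z.a_closed[of x y] additive_subgroup.a_closed[OF I.is_additive_subgroup, of x y]
      by (auto simp: Z_simps)
    show "x \<otimes>\<^bsub>Z\<^esub> y \<in> ext P \<inter> carrier Z" if "x \<in> carrier Z" "y \<in> ext P \<inter> carrier Z" for x y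
      using that Z.m_closed[of x y] I.I_l_closed[of y x] c by (auto simp: Z_simps)
    show "\<zero>\<^bsub>Z\<^esub> \<in> ext P \<inter> carrier Z"
      using Z.zero_closed additive_subgroup.zero_closed[OF I.is_additive_subgroup]
      by (simp add: Z_simps)
  qed simp
  moreover have "carrier Z \<noteq> ext P \<inter> carrier Z"
  proof
    assume "carrier Z = ext P \<inter> carrier Z"
    then have "fr 1 1 \<in> ext P" using Z.one_closed by (auto simp: Z_simps L_one)
    then show False using fr_ext_iff[of 1 1] pspec_GL2D(2)[OF P] by (simp add: closed)
  qed
  moreover have "a \<in> ext P \<inter> carrier Z \<or> b \<in> ext P \<inter> carrier Z"
    if ab: "a \<in> carrier Z" "b \<in> carrier Z" "a \<otimes>\<^bsub>Z\<^esub> b \<in> ext P \<inter> carrier Z" for a b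
  proof -
    obtain x s where x: "a = fr x s" "x \<in> carrier GL2" "s \<in> den" using subsetD[OF c ab(1)] carrier_LE by metis
    obtain y t where y: "b = fr y t" "y \<in> carrier GL2" "t \<in> den" using subsetD[OF c ab(2)] carrier_LE by metis
    show ?thesis using ab x y pspec_GL2D(3)[OF P x(2) y(2)]
      by (simp add: Z_simps L_simps fr_ext_iff closed)
  qed
  ultimately show ?thesis unfolding spec_def using Z.is_cring by (auto intro!: primeidealI)
qed

end

end

section \<open>Strata and the torus action\<close>

text \<open>The intersection of \<open>Y\<close> is the largest ideal that all members contain, so
  the closure is its vanishing set. Intersecting with \<open>carrier A\<close> matters for empty
  \<open>Y\<close>, where \<open>\<Inter>Y\<close> is the whole type.\<close>

lemma closure_of_zariski:
  assumes A: "cring A" and X: "X \<subseteq> spec A" and Y: "Y \<subseteq> X"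
  shows "P \<in> zariski A X closure_of Y \<longleftrightarrow> P \<in> X \<and> carrier A \<inter> \<Inter>Y \<subseteq> P"
proof
  interpret cring A by (rule A)
  define I where "I = carrier A \<inter> \<Inter>Y"
  have id: "ideal Q A" if "Q \<in> Y" for Q using that X Y by (auto simp: spec_def primeideal_def)
  have "ideal I A"
  proof (rule idealI_cring)
    show "\<zero>\<^bsub>A\<^esub> \<in> I"
      using id by (auto simp: I_def ideal_def intro: additive_subgroup.zero_closed)
    show "x \<oplus>\<^bsub>A\<^esub> y \<in> I" if "x \<in> I" "y \<in> I" for x y
    proof -
      have "x \<oplus>\<^bsub>A\<^esub> y \<in> Q" if "Q \<in> Y" for Q
        using additive_subgroup.a_closed[OF ideal.axioms(1)[OF id[OF that]]] \<open>x \<in> I\<close> \<open>y \<in> I\<close> that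
        by (simp add: I_def)
      then show ?thesis using that by (simp add: I_def)
    qed
    show "x \<otimes>\<^bsub>A\<^esub> y \<in> I" if "x \<in> carrier A" "y \<in> I" for x y
      using that ideal.I_l_closed[OF id] by (simp add: I_def)
  qed (simp add: I_def)
  then have "closedin (zariski A X) {P \<in> X. I \<subseteq> P}"
    using closedin_zariski[OF A X] by blast
  moreover have "Y \<subseteq> {P \<in> X. I \<subseteq> P}" using Y by (auto simp: I_def)
  ultimately have sub: "zariski A X closure_of Y \<subseteq> {P \<in> X. I \<subseteq> P}" by (rule closure_of_minimal[rotated])
  assume "P \<in> zariski A X closure_of Y"
  then show "P \<in> X \<and> carrier A \<inter> \<Inter>Y \<subseteq> P" using sub by (auto simp: I_def)
next
  assume P: "P \<in> X \<and> carrier A \<inter> \<Inter>Y \<subseteq> P"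
  obtain I where I: "ideal I A" and c: "zariski A X closure_of Y = {P \<in> X. I \<subseteq> P}"
    using closedin_zariski[OF A X, of "zariski A X closure_of Y"] closedin_closure_of by blast
  have "Y \<subseteq> zariski A X closure_of Y"
    by (rule closure_of_subset) (simp add: topspace_zariski[OF A X] Y)
  then have "I \<subseteq> carrier A \<inter> \<Inter>Y" using c ideal.Icarr[OF I] by auto
  then show "P \<in> zariski A X closure_of Y" using P c by blast
qed

text \<open>Such a map fixes all polynomials, hence all their quotients. Relations between torus
  automorphisms can thus be checked on generators.\<close>

lemma ring_hom_fixing_gens:
  fixes \<phi> :: "'k::field mat_fract \<Rightarrow> 'k mat_fract"
  assumes phi_add: "\<And>x y. \<phi> (x + y) = \<phi> x + \<phi> y" and phi_mult: "\<And>x y. \<phi> (x * y) = \<phi> x * \<phi> y"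
    and fix_gens: "\<And>c. \<phi> (scalar c) = scalar c" "\<phi> ya = ya" "\<phi> yb = yb" "\<phi> yc = yc" "\<phi> yd = yd"
  shows "\<phi> x = x"
proof -
  have p: "\<phi> (to_frac p) = to_frac p" for p
    by (induction p rule: mat_poly_induct)
      (use fix_gens(1) in \<open>simp_all add: to_frac_simps phi_add phi_mult fix_gens scalar_def\<close>)
  obtain p q where x: "x = Fract p q" "q \<noteq> 0" by (metis Fract_cases)
  then have "x * to_frac q = to_frac p" by (simp add: Fract_to_frac to_frac_eq_0_iff)
  then have "\<phi> x * to_frac q = x * to_frac q" by (metis p phi_mult)
  then show ?thesis using x(2) by (simp add: to_frac_eq_0_iff)
qed

lemma act_gen_eigen:
  assumes "h \<in> torus" "g \<in> {ya, yb, yc}"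
  shows "\<exists>c. act h g = scalar c * g"
proof -
  obtain \<alpha>1 \<alpha>2 \<beta>1 \<beta>2 where h: "h = (\<alpha>1, \<alpha>2, \<beta>1, \<beta>2)" by (cases h)
  show ?thesis using assms act_gens[of \<alpha>1 \<alpha>2 \<beta>1 \<beta>2] unfolding h by blast
qed

lemma act_one: "act (1, 1, 1, 1) x = x"
proof -
  have h: "(1, 1, 1, 1) \<in> torus" by (simp add: torus_def)
  show ?thesis
    by (rule ring_hom_fixing_gens) (simp_all add: act_hom[OF h] act_scalar[OF h] act_gens[OF h] scalar_simps)
qed

lemma act_inverse:
  assumes h: "h \<in> torus" shows "\<exists>h'\<in>torus. \<forall>x. act h (act h' x) = x"
proof -
  obtain a b c d where e: "h = (a, b, c, d)" by (cases h)
  have n: "a \<noteq> 0" "b \<noteq> 0" "c \<noteq> 0" "d \<noteq> 0" using h by (auto simp: e torus_def)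
  let ?h = "(inverse a, inverse b, inverse c, inverse d)"
  have h': "?h \<in> torus" using n by (simp add: torus_def)
  note h'' = h[unfolded e]
  have s: "scalar (inverse x * inverse y) * (scalar (x * y) * z) = z" if "x \<noteq> 0" "y \<noteq> 0" for x y z
  proof -
    have e: "inverse x * inverse y * (x * y) = 1" using that by (simp add: field_simps)
    show ?thesis unfolding mult.assoc[symmetric, of _ _ z] scalar_simps(1)[symmetric] e
      by (simp add: scalar_simps)
  qed
  have "act h (act ?h x) = x" for x unfolding e
    by (rule ring_hom_fixing_gens[where \<phi>="\<lambda>x. act (a, b, c, d) (act ?h x)"])
      (simp_all add: act_hom[OF h''] act_hom[OF h'] act_scalar[OF h''] act_scalar[OF h']
        act_gens[OF h''] act_gens[OF h'] s n)
  then show ?thesis using h' by blast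
qed

lemma act_diff: "h \<in> torus \<Longrightarrow> act h (x - y) = act h x - act h y"
  using act_hom(1)[of h "x - y" y] by simp

lemma act_coset:
  assumes h: "h \<in> torus" and J: "act h ` J = J"
  shows "act h ` (J +>\<^bsub>GL2\<^esub> s) = J +>\<^bsub>GL2\<^esub> act h s"
proof (intro equalityI subsetI)
  fix z assume "z \<in> act h ` (J +>\<^bsub>GL2\<^esub> s)"
  then obtain y where "z = act h y" "y - s \<in> J" by (auto simp: coset_mem_iff)
  then show "z \<in> J +>\<^bsub>GL2\<^esub> act h s" using J by (auto simp: coset_mem_iff simp flip: act_diff[OF h])
next
  fix z assume "z \<in> J +>\<^bsub>GL2\<^esub> act h s"
  then obtain y where "y \<in> J" "z - act h s = act h y" using J by (auto simp: coset_mem_iff)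
  then have "z = act h (y + s)" "y + s \<in> J +>\<^bsub>GL2\<^esub> s" by (auto simp: act_hom[OF h] coset_mem_iff algebra_simps)
  then show "z \<in> act h ` (J +>\<^bsub>GL2\<^esub> s)" by blast
qed

section \<open>Homogeneous elements of the quotients\<close>

lemma homogeneous_coset_iff:
  assumes J: "poisson_H_prime J" and s: "s \<in> carrier GL2"
  shows "homogeneous J (J +>\<^bsub>GL2\<^esub> s) \<longleftrightarrow> s \<notin> J \<and> (\<forall>h\<in>torus. \<exists>c. act h s - scalar c * s \<in> J)"
proof -
  have i: "ideal J GL2" using J pspec_GL2D(1) by (auto simp: poisson_H_prime_def)
  have "act h ` (J +>\<^bsub>GL2\<^esub> s) = (J +>\<^bsub>GL2\<^esub> scalar c) \<otimes>\<^bsub>GL2 Quot J\<^esub> (J +>\<^bsub>GL2\<^esub> s)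
      \<longleftrightarrow> act h s - scalar c * s \<in> J" if "h \<in> torus" for h c
  proof -
    have "act h ` J = J" using J that by (simp add: poisson_H_prime_def)
    then show ?thesis
      by (simp add: act_coset[OF that] Quot_simps[OF i scalar_in_GL2 s] coset_eq_iff[OF i])
  qed
  then show ?thesis
    by (simp add: homogeneous_def coset_closed s Quot_zero coset_eq_iff[OF i])
qed

lemma homogeneousE:
  assumes "homogeneous J X" obtains s where "s \<in> carrier GL2" "X = J +>\<^bsub>GL2\<^esub> s"
  using assms by (auto simp: homogeneous_def carrier_Quot)

lemma homogeneous_mult:
  assumes J: "poisson_H_prime J" and "homogeneous J X" "homogeneous J Y"
  shows "homogeneous J (X \<otimes>\<^bsub>GL2 Quot J\<^esub> Y)"
proof -
  obtain s t where s: "s \<in> carrier GL2" "X = J +>\<^bsub>GL2\<^esub> s" and t: "t \<in> carrier GL2" "Y = J +>\<^bsub>GL2\<^esub> t"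
    using assms homogeneousE by metis
  have p: "J \<in> pspec GL2 GL2_br" using J by (simp add: poisson_H_prime_def)
  note i = pspec_GL2D(1)[OF p]
  note hs = assms(2)[unfolded s(2) homogeneous_coset_iff[OF J s(1)]]
  note ht = assms(3)[unfolded t(2) homogeneous_coset_iff[OF J t(1)]]
  have "\<exists>c. act h (s * t) - scalar c * (s * t) \<in> J" if h: "h \<in> torus" for h
  proof -
    obtain c e where ce: "act h s - scalar c * s \<in> J" "act h t - scalar e * t \<in> J"
      using hs ht h by blast
    have "act h s * (act h t - scalar e * t) + scalar e * t * (act h s - scalar c * s) \<in> J"
      by (intro ideal_GL2D(3,6)[OF i] ce act_closed[OF h] GL2_closed scalar_in_GL2 s t)
    then show ?thesis
      by (intro exI[of _ "c * e"]) (simp add: act_hom[OF h] scalar_simps algebra_simps)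
  qed
  then show ?thesis using hs ht pspec_GL2D(3)[OF p s(1) t(1)]
    by (simp add: s(2) t(2) Quot_simps[OF i s(1) t(1)] homogeneous_coset_iff[OF J] GL2_closed s t)
qed

lemma homogeneous_eigen:
  assumes J: "poisson_H_prime J" and "s \<in> carrier GL2" "s \<notin> J" "\<And>h. h \<in> torus \<Longrightarrow> \<exists>c. act h s = scalar c * s"
  shows "homogeneous J (J +>\<^bsub>GL2\<^esub> s)"
proof -
  have i: "ideal J GL2" using J pspec_GL2D(1) by (auto simp: poisson_H_prime_def)
  show ?thesis using assms ideal_GL2D(2)[OF i] by (metis homogeneous_coset_iff right_minus_eq)
qed

lemma homogeneous_one: "poisson_H_prime J \<Longrightarrow> homogeneous J (J +>\<^bsub>GL2\<^esub> 1)"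
  using act_scalar[of _ 1] pspec_GL2D(2)[of J]
  by (intro homogeneous_eigen) (auto simp: GL2_01_closed scalar_simps poisson_H_prime_def intro!: exI[of _ 1])

section \<open>Homogeneous elements and the primes of a stratum\<close>

lemma stratumD:
  assumes "P \<in> stratum K" shows "P \<in> pspec GL2 GL2_br" "K \<subseteq> P"
proof -
  \<comment> \<open>The identity of the torus contributes \<open>P\<close> itself to the
    intersection.\<close>
  have "(\<Inter>h\<in>torus. act h ` P) \<subseteq> act (1, 1, 1, 1) ` P" by (rule INF_lower) (simp add: torus_def)
  then show "P \<in> pspec GL2 GL2_br" "K \<subseteq> P" using assms by (auto simp: stratum_def act_one)
qed

text \<open>If \<open>h'\<close> inverts \<open>h\<close>, then \<open>h' s\<close> is a scalar
  multiple of \<open>s\<close> modulo \<open>J\<close>, so it stays in \<open>P\<close> and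
  \<open>s\<close> lies in \<open>h(P)\<close>. The intersection of all \<open>h(P)\<close> is
  \<open>K\<close>. This keeps denominators out of the primes of the strata.\<close>

lemma homogeneous_in_stratum:
  assumes J: "poisson_H_prime J" and JK: "J \<subseteq> K" and P: "P \<in> stratum K"
    and s: "s \<in> carrier GL2" "homogeneous J (J +>\<^bsub>GL2\<^esub> s)" "s \<in> P"
  shows "s \<in> K"
proof -
  note i = pspec_GL2D(1)[OF stratumD(1)[OF P]]
  have "s \<in> act h ` P" if h: "h \<in> torus" for h
  proof -
    obtain h' where h': "h' \<in> torus" "act h (act h' s) = s" using act_inverse[OF h] by blast
    obtain c where "act h' s - scalar c * s \<in> J"
      using s(2) h'(1) unfolding homogeneous_coset_iff[OF J s(1)] by blast
    then have "act h' s - scalar c * s + scalar c * s \<in> P"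
      by (intro ideal_GL2D(3,6)[OF i] s scalar_in_GL2) (use JK stratumD(2)[OF P] in blast)
    then show ?thesis using h'(2) by (metis diff_add_cancel image_eqI)
  qed
  then show ?thesis using P by (auto simp: stratum_def)
qed

lemma coset_in_ideal_quot_iff:
  assumes "ideal J GL2" "ideal K GL2" "J \<subseteq> K"
  shows "J +>\<^bsub>GL2\<^esub> s \<in> ideal_quot GL2 J K \<longleftrightarrow> s \<in> K"
proof
  assume "J +>\<^bsub>GL2\<^esub> s \<in> ideal_quot GL2 J K"
  then obtain y where y: "y \<in> K" "s - y \<in> J" by (auto simp: ideal_quot_def coset_eq_iff[OF assms(1)])
  then have "s - y + y \<in> K" using ideal_GL2D(3)[OF assms(2), of "s - y" y] assms(3) by blast
  then show "s \<in> K" by simp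
qed (simp add: ideal_quot_def)

lemma quot_proj_coset:
  assumes "ideal J GL2" "ideal K GL2" "J \<subseteq> K"
  shows "quot_proj GL2 K (J +>\<^bsub>GL2\<^esub> s) = K +>\<^bsub>GL2\<^esub> s"
proof -
  have "K +>\<^bsub>GL2\<^esub> y = K +>\<^bsub>GL2\<^esub> s" if "y \<in> J +>\<^bsub>GL2\<^esub> s" for y
    using that assms(3) by (auto simp: coset_mem_iff coset_eq_iff[OF assms(2)])
  moreover have "s \<in> J +>\<^bsub>GL2\<^esub> s" using ideal_GL2D(2)[OF assms(1)] by (simp add: coset_mem_iff)
  ultimately show ?thesis unfolding quot_proj_def by blast
qed

lemma E_iff: "X \<in> E J \<longleftrightarrow> homogeneous J X"
  by (simp add: E_def)

lemma E2_iff: "X \<in> E2 J K \<longleftrightarrow> homogeneous J X \<and> X \<notin> ideal_quot GL2 J K"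
  by (simp add: E2_def)

lemma quotient_localization_E:
  assumes J: "poisson_H_prime J" shows "quotient_localization J (E J)"
proof
  show "J \<in> pspec GL2 GL2_br" using J by (simp add: poisson_H_prime_def)
qed (auto simp: E_def Quot_one homogeneous_one[OF J] homogeneous_mult[OF J], auto simp: homogeneous_def)

lemma quotient_localization_E2:
  assumes J: "poisson_H_prime J" and K: "poisson_H_prime K" and JK: "J \<subseteq> K"
  shows "quotient_localization J (E2 J K)"
proof
  show p: "J \<in> pspec GL2 GL2_br" using J by (simp add: poisson_H_prime_def)
  have q: "K \<in> pspec GL2 GL2_br" using K by (simp add: poisson_H_prime_def)
  note mem = coset_in_ideal_quot_iff[OF pspec_GL2D(1)[OF p] pspec_GL2D(1)[OF q] JK]
  show "\<one>\<^bsub>GL2 Quot J\<^esub> \<in> E2 J K"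
    using pspec_GL2D(2)[OF q] by (simp add: E2_def Quot_one homogeneous_one[OF J] mem)
  show "X \<otimes>\<^bsub>GL2 Quot J\<^esub> Y \<in> E2 J K" if "X \<in> E2 J K" "Y \<in> E2 J K" for X Y
  proof -
    have h: "homogeneous J X" "homogeneous J Y" using that by (auto simp: E2_def)
    obtain s t where "s \<in> carrier GL2" "X = J +>\<^bsub>GL2\<^esub> s" "t \<in> carrier GL2" "Y = J +>\<^bsub>GL2\<^esub> t"
      using h homogeneousE by metis
    then show ?thesis using that homogeneous_mult[OF J h]
      by (simp add: E2_def mem Quot_simps[OF pspec_GL2D(1)[OF p]] pspec_GL2D(3)[OF q])
  qed
qed (auto simp: E2_def homogeneous_def)

section \<open>Comparison of the two maps\<close>

locale H_prime_pair =
  fixes J K :: "'k::field_char_0 mat_fract set"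
  assumes J: "poisson_H_prime J" and K: "poisson_H_prime K" and JK: "J \<subseteq> K"
begin

sublocale RJ: quotient_localization J "E J" by (rule quotient_localization_E[OF J])
sublocale RJK: quotient_localization J "E2 J K" by (rule quotient_localization_E2[OF J K JK])
sublocale RK: quotient_localization K "E K" by (rule quotient_localization_E[OF K])

lemma mem_RJ_den: "s \<in> RJ.den \<longleftrightarrow> s \<in> carrier GL2 \<and> homogeneous J (J +>\<^bsub>GL2\<^esub> s)"
  by (simp add: RJ.den_def E_iff)

lemma mem_RK_den: "s \<in> RK.den \<longleftrightarrow> s \<in> carrier GL2 \<and> homogeneous K (K +>\<^bsub>GL2\<^esub> s)"
  by (simp add: RK.den_def E_iff)

lemma mem_RJK_den: "s \<in> RJK.den \<longleftrightarrow> s \<in> carrier GL2 \<and> homogeneous J (J +>\<^bsub>GL2\<^esub> s) \<and> s \<notin> K"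
  using coset_in_ideal_quot_iff[OF RJ.J_ideal RK.J_ideal JK] by (auto simp: RJK.den_def E2_iff)

lemma RJK_den_RJ: "s \<in> RJK.den \<Longrightarrow> s \<in> RJ.den"
  by (simp add: mem_RJ_den mem_RJK_den)

text \<open>An eigenvector relation modulo \<open>J\<close> persists modulo \<open>K\<close>, and
  \<open>s\<close> outside \<open>K\<close> keeps the coset nonzero. So the projection sends
  denominators to denominators, as \<open>f_map\<close> requires.\<close>

lemma RJK_den_RK: "s \<in> RJK.den \<Longrightarrow> s \<in> RK.den"
  using JK by (auto simp: mem_RK_den mem_RJK_den homogeneous_coset_iff[OF J] homogeneous_coset_iff[OF K]) blast

lemma den_disjoint:
  "P \<in> stratum J \<Longrightarrow> RJ.den \<inter> P = {}" "P \<in> stratum J \<Longrightarrow> RJK.den \<inter> P = {}"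
  "P \<in> stratum K \<Longrightarrow> RJK.den \<inter> P = {}" "P \<in> stratum K \<Longrightarrow> RK.den \<inter> P = {}"
proof -
  show 1: "RJ.den \<inter> P = {}" if "P \<in> stratum J"
    using homogeneous_in_stratum[OF J _ that] RJ.den_not_in_J mem_RJ_den by blast
  show "RJK.den \<inter> P = {}" if "P \<in> stratum J" using 1[OF that] RJK_den_RJ by blast
  show "RJK.den \<inter> P = {}" if "P \<in> stratum K"
    using homogeneous_in_stratum[OF J JK that] mem_RJK_den by blast
  show "RK.den \<inter> P = {}" if "P \<in> stratum K"
    using homogeneous_in_stratum[OF K _ that] RK.den_not_in_J mem_RK_den by blast
qed

lemma PZ_eq: "PZ J = RJ.Z" "PZ K = RK.Z" "PZ2 J K = RJK.Z"
  by (simp_all add: PZ_def PZ2_def)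

lemma stratum_map_eq:
  "P \<in> stratum J \<Longrightarrow> stratum_map J P = RJ.ext P \<inter> carrier RJ.Z"
  "P \<in> stratum K \<Longrightarrow> stratum_map K P = RK.ext P \<inter> carrier RK.Z"
  by (simp_all add: stratum_map_def PZ_eq RJ.loc_ext_eq RK.loc_ext_eq stratumD den_disjoint)

text \<open>On representatives in \<open>R\<close>, both \<open>g_map\<close> and
  \<open>f_map\<close> keep numerator and denominator; only the localization in which the class is
  formed changes.\<close>

lemma g_map_fr:
  assumes x: "x \<in> carrier GL2" "s \<in> RJK.den" shows "g_map J (RJK.fr x s) = RJ.fr x s"
  unfolding g_map_def loc_map_def id_apply
proof (rule RJK.UN_fr[OF x])
  fix y t assume "y \<in> carrier GL2" "t \<in> RJK.den" "s * y - t * x \<in> J"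
  then have "RJ.fr y t = RJ.fr x s" using x by (simp add: RJ.fr_eq_iff RJK_den_RJ)
  then show "fraction (GL2 Quot J) (E J) (J +>\<^bsub>GL2\<^esub> y) (J +>\<^bsub>GL2\<^esub> t) = RJ.fr x s" by (simp add: RJ.fr_def)
qed

lemma f_map_fr:
  assumes x: "x \<in> carrier GL2" "s \<in> RJK.den" shows "f_map K (RJK.fr x s) = RK.fr x s"
  unfolding f_map_def loc_map_def
proof (rule RJK.UN_fr[OF x])
  fix y t assume "y \<in> carrier GL2" "t \<in> RJK.den" "s * y - t * x \<in> J"
  then have "RK.fr y t = RK.fr x s" using x JK by (auto simp: RK.fr_eq_iff RJK_den_RK)
  then show "fraction (GL2 Quot K) (E K) (quot_proj GL2 K (J +>\<^bsub>GL2\<^esub> y)) (quot_proj GL2 K (J +>\<^bsub>GL2\<^esub> t)) = RK.fr x s"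
    by (simp add: RK.fr_def quot_proj_coset[OF RJ.J_ideal RK.J_ideal JK])
qed

text \<open>Membership on either side means that the numerator lies in \<open>P\<close>. The formula
  agrees with the one in \<open>spec_map_f\<close>, so both strata are compared inside
  \<open>spec (PZ2 J K)\<close> by contracted extensions.\<close>

lemma spec_map_g:
  assumes P: "P \<in> stratum J"
  shows "spec_map (PZ2 J K) (g_map J) (stratum_map J P) = RJK.ext P \<inter> carrier RJK.Z"
proof -
  note PD = stratumD[OF P]
  have "g_map J z \<in> stratum_map J P \<longleftrightarrow> z \<in> RJK.ext P" if z: "z \<in> carrier RJK.Z" for z
  proof -
    obtain x s where x: "z = RJK.fr x s" "x \<in> carrier GL2" "s \<in> RJK.den" "RJK.cen x s"
      using z by (auto simp: RJK.carrier_Z)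
    show ?thesis
      using x RJK_den_RJ[OF x(3)]
      by (simp add: g_map_fr stratum_map_eq(1)[OF P] RJ.Z_iff RJ.fr_ext_iff[OF PD den_disjoint(1)[OF P]]
          RJK.fr_ext_iff[OF PD den_disjoint(2)[OF P]])
  qed
  then show ?thesis by (auto simp: spec_map_def PZ_eq)
qed

lemma spec_map_f:
  assumes P: "P \<in> stratum K"
  shows "spec_map (PZ2 J K) (f_map K) (stratum_map K P) = RJK.ext P \<inter> carrier RJK.Z"
proof -
  note PD = stratumD[OF P]
  have JP: "J \<subseteq> P" using JK PD by blast
  have "f_map K z \<in> stratum_map K P \<longleftrightarrow> z \<in> RJK.ext P" if z: "z \<in> carrier RJK.Z" for z
  proof -
    obtain x s where x: "z = RJK.fr x s" "x \<in> carrier GL2" "s \<in> RJK.den" "RJK.cen x s"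
      using z by (auto simp: RJK.carrier_Z)
    \<comment> \<open>Centrality is a family of memberships in \<open>J\<close>, and these pass to
      the larger ideal \<open>K\<close>.\<close>
    have "RK.cen x s" using x(4) JK by (auto simp: RJK.cen_def RK.cen_def)
    then show ?thesis
      using x RJK_den_RK[OF x(3)]
      by (simp add: f_map_fr stratum_map_eq(2)[OF P] RK.Z_iff RK.fr_ext_iff[OF PD den_disjoint(4)[OF P]]
          RJK.fr_ext_iff[OF PD(1) JP den_disjoint(3)[OF P]])
  qed
  then show ?thesis by (auto simp: spec_map_def PZ_eq)
qed

lemma mem_phi_iff:
  assumes "Y \<in> CL (stratum_top J)"
  shows "P \<in> phi J K Y \<longleftrightarrow> P \<in> stratum K \<and> carrier GL2 \<inter> \<Inter>Y \<subseteq> P"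
proof -
  have X: "pspec GL2 GL2_br \<subseteq> spec GL2" by (auto simp: pspec_def spec_def)
  have "Y \<subseteq> topspace (stratum_top J)" using assms by (auto simp: CL_def dest: closedin_subset)
  then have "Y \<subseteq> pspec GL2 GL2_br"
    by (auto simp: stratum_top_def topspace_zariski[OF GL2_cring X])
  then show ?thesis
    using assms stratumD(1) by (auto simp: phi_def closure_of_zariski[OF GL2_cring X])
qed

text \<open>The closure is a vanishing set by \<open>closure_of_zariski\<close>, and
  \<open>fr_ext_iff\<close> turns it into a test on numerators. Compared with
  \<open>mem_phi_iff\<close>, only numerators of central fractions are tested.\<close>

lemma mem_fg_bar_iff:
  assumes "Y \<in> CL (stratum_top J)"
  shows "P \<in> fg_bar J K Y \<longleftrightarrow> P \<in> stratum K \<and> (\<forall>x\<in>carrier GL2. \<forall>s\<in>RJK.den.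
    RJK.cen x s \<longrightarrow> (\<forall>Q\<in>Y. x \<in> Q) \<longrightarrow> x \<in> P)"
proof (cases "P \<in> stratum K")
  case P: True
  have Y: "Y \<subseteq> stratum J"
    using assms by (auto simp: CL_def stratum_top_def dest!: closedin_subset)
  have JP: "J \<subseteq> P" using JK stratumD(2)[OF P] by blast
  have eP: "RJK.ext P \<inter> carrier RJK.Z \<in> spec RJK.Z"
    by (rule RJK.ext_Z_prime[OF stratumD(1)[OF P] JP den_disjoint(3)[OF P]])
  have eQ: "RJK.ext Q \<inter> carrier RJK.Z \<in> spec RJK.Z" if "Q \<in> stratum J" for Q
    by (rule RJK.ext_Z_prime[OF stratumD[OF that] den_disjoint(2)[OF that]])
  have im: "spec_map (PZ2 J K) (g_map J) ` stratum_map J ` Y = (\<lambda>Q. RJK.ext Q \<inter> carrier RJK.Z) ` Y"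
    using Y by (auto simp: image_image spec_map_g intro!: image_cong)
  have "stratum_map K P \<in> spec (PZ K)"
    unfolding stratum_map_eq(2)[OF P] PZ_eq
    by (rule RK.ext_Z_prime[OF stratumD[OF P] den_disjoint(4)[OF P]])
  then have "P \<in> fg_bar J K Y \<longleftrightarrow> RJK.ext P \<inter> carrier RJK.Z \<in>
      spec_top RJK.Z closure_of ((\<lambda>Q. RJK.ext Q \<inter> carrier RJK.Z) ` Y)"
    using assms P
    by (simp add: fg_bar_def spec_bar_def im[unfolded PZ_eq] spec_map_f[OF P, unfolded PZ_eq] PZ_eq)
  also have "\<dots> \<longleftrightarrow> carrier RJK.Z \<inter> \<Inter>((\<lambda>Q. RJK.ext Q \<inter> carrier RJK.Z) ` Y) \<subseteq> RJK.ext P \<inter> carrier RJK.Z"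
    using eP eQ Y by (subst closure_of_zariski[OF RJK.Z_cring]) auto
  also have "\<dots> \<longleftrightarrow> (\<forall>z\<in>carrier RJK.Z. (\<forall>Q\<in>Y. z \<in> RJK.ext Q) \<longrightarrow> z \<in> RJK.ext P)"
    by blast
  also have "\<dots> \<longleftrightarrow> (\<forall>x\<in>carrier GL2. \<forall>s\<in>RJK.den. RJK.cen x s \<longrightarrow>
      (\<forall>Q\<in>Y. RJK.fr x s \<in> RJK.ext Q) \<longrightarrow> RJK.fr x s \<in> RJK.ext P)"
    unfolding RJK.carrier_Z by blast
  also have "\<dots> \<longleftrightarrow> (\<forall>x\<in>carrier GL2. \<forall>s\<in>RJK.den. RJK.cen x s \<longrightarrow> (\<forall>Q\<in>Y. x \<in> Q) \<longrightarrow> x \<in> P)"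
  proof -
    have "RJK.fr x s \<in> RJK.ext Q \<longleftrightarrow> x \<in> Q" if "x \<in> carrier GL2" "s \<in> RJK.den" "Q \<in> Y" for x s Q
    proof -
      have Q: "Q \<in> stratum J" using Y that by blast
      show ?thesis by (rule RJK.fr_ext_iff[OF stratumD[OF Q] den_disjoint(2)[OF Q] that(1,2)])
    qed
    then show ?thesis
      using RJK.fr_ext_iff[OF stratumD(1)[OF P] JP den_disjoint(3)[OF P]] by (meson)
  qed
  finally show ?thesis using P by blast
next
  case False
  then show ?thesis using assms by (simp add: fg_bar_def)
qed

lemma phi_eq_fg_bar: "phi J K = fg_bar J K"
proof
  fix Y
  show "phi J K Y = fg_bar J K Y"
  proof (cases "Y \<in> CL (stratum_top J)")
    case Y: True
    have YJ: "Y \<subseteq> stratum J"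
      using Y by (auto simp: CL_def stratum_top_def dest!: closedin_subset)
    \<comment> \<open>The substantial inclusion: testing on numerators of central fractions already
      forces all of \<open>\<Inter>Y\<close> into \<open>P\<close>.\<close>
    have *: "carrier GL2 \<inter> \<Inter>Y \<subseteq> P"
      if P: "P \<in> stratum K" and fg: "\<forall>x\<in>carrier GL2. \<forall>s\<in>RJK.den.
        RJK.cen x s \<longrightarrow> (\<forall>Q\<in>Y. x \<in> Q) \<longrightarrow> x \<in> P" for P
    proof (rule ccontr)
      assume "\<not> carrier GL2 \<inter> \<Inter>Y \<subseteq> P"
      then obtain x where x: "x \<in> carrier GL2" "x \<in> \<Inter>Y" "x \<notin> P" by blast
      have JP: "J \<subseteq> P" using JK stratumD(2)[OF P] by blast
      have hom: "homogeneous J (J +>\<^bsub>GL2\<^esub> g)" if "g \<in> {ya, yb, yc}" "g \<notin> J" for g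
        by (rule homogeneous_eigen[OF J])
          (use that in \<open>auto simp: to_frac_in_GL2 act_gen_eigen simp del: split_paired_All split_paired_Ex\<close>)
      have nQ: "g \<notin> Q" if "g \<in> {ya, yb, yc}" "g \<notin> J" "Q \<in> Y" for g Q
        \<comment> \<open>A generator outside \<open>J\<close> is homogeneous, and a prime in the
          stratum of \<open>J\<close> contains no homogeneous element outside
          \<open>J\<close>.\<close>
        using homogeneous_in_stratum[OF J subset_refl, of Q g] hom that YJ by (auto simp: to_frac_in_GL2)
      have bc: "yb \<in> \<Union>Y \<Longrightarrow> yb \<in> J" "yc \<in> \<Union>Y \<Longrightarrow> yc \<in> J" using nQ by auto
      have YQ: "Y \<subseteq> pspec GL2 GL2_br" using YJ stratumD(1) by blast
      obtain w i r v where w: "w \<in> carrier GL2" "w \<notin> P" "w \<in> \<Inter>Y" and v: "v \<in> {yb, yc}"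
        and r: "v \<notin> P \<or> r = 0"
        and c: "\<forall>y\<in>carrier GL2. ya ^ i * v ^ r * GL2_br w y - w * GL2_br (ya ^ i * v ^ r) y \<in> J"
        by (rule exists_central_fraction[OF RJ.J_ideal stratumD(1)[OF P] YQ bc x])
      have den: "g \<in> RJK.den" if g: "g \<in> {ya, yb, yc}" "g \<notin> P" for g
        using g hom[OF g(1)] JP stratumD(2)[OF P] by (auto simp: mem_RJK_den to_frac_in_GL2)
      have pow: "g ^ n \<in> RJK.den" if "g \<in> RJK.den" for g n
        using that by (induction n) (simp_all add: RJK.den_one RJK.den_mult)
      have "ya \<in> RJK.den" by (rule den[OF _ pspec_gens(2)[OF stratumD(1)[OF P]]]) simp
      \<comment> \<open>For \<open>r = 0\<close> the element \<open>v\<close> may lie in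
        \<open>P\<close>, but the power is then 1.\<close>
      moreover have "v ^ r \<in> RJK.den"
      proof (cases "r = 0")
        case False
        then show ?thesis by (intro pow den) (use r v in auto)
      qed (simp add: RJK.den_one)
      ultimately have "ya ^ i * v ^ r \<in> RJK.den" by (intro RJK.den_mult pow[of ya])
      moreover have "RJK.cen w (ya ^ i * v ^ r)" unfolding RJK.cen_def by (rule c)
      ultimately have "w \<in> P" using fg w(1,3) by blast
      then show False using w(2) by simp
    qed
    show ?thesis
    proof (intro Set.set_eqI iffI)
      fix P assume "P \<in> phi J K Y"
      then have "P \<in> stratum K" and "carrier GL2 \<inter> \<Inter>Y \<subseteq> P" by (simp_all add: mem_phi_iff[OF Y])
      then show "P \<in> fg_bar J K Y" unfolding mem_fg_bar_iff[OF Y] by blast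
    next
      fix P assume "P \<in> fg_bar J K Y"
      then show "P \<in> phi J K Y" unfolding mem_phi_iff[OF Y] mem_fg_bar_iff[OF Y] using * by simp
    qed
  \<comment> \<open>Off \<open>CL (stratum_top J)\<close> both extensional functions are
    \<open>undefined\<close>.\<close>
  qed (simp add: phi_def fg_bar_def)
qed

end

theorem corollary4p6:
  fixes J K :: "'k::{alg_closed_field, field_char_0} mat_fract set"
  assumes "poisson_H_prime J" and "poisson_H_prime K" and "J \<subset> K"
  shows "phi J K = fg_bar J K"
proof -
  interpret H_prime_pair J K using assms by unfold_locales auto
  show ?thesis by (rule phi_eq_fg_bar)
qed

end
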